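(* Let $D$ be the derivation (formal derivative) on the ring of Laurent polynomials in the commuting variables $u,v,z$ determined by the grammar $$z\to vz^2,\qquad v\to uv^2z,\qquad u\to u^2vz,$$ i.e. $D(z)=vz^2$, $D(v)=uv^2z$, $D(u)=u^2vz$, extended to all Laurent polynomials by linearity and the Leibniz rule. Then for every $n\ge 1$, $$D^{n-1}(vz)=v^{n}z^{n}R_n(u).$$
   Context: A rooted tree on $[n]=\{1,\dots,n\}$ is a tree on vertex set $[n]$ with a distinguished root; an edge is written $(i,j)$ where $j$ is a child of $i$. Every vertex is considered a descendant of itself. An edge $(i,j)$ is called improper if some descendant of $j$ is smaller than $i$, and proper otherwise. Let $R(n,k)$ be the number of rooted trees on $[n]$ with exactly $k$ improper edges, and $R_n(u)=\sum_{k=0}^{n-1}R(n,k)u^k$. *)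

theory Defs
  imports
    Main
    "HOL-Library.Poly_Mapping"
    "HOL-Library.Product_Plus"
begin

section \<open>Laurent polynomials in three commuting variables\<close>

text \<open>
  The ring of Laurent polynomials in \<open>u, v, z\<close> over a commutative ring \<open>'a\<close> is the group ring
  of \<open>\<int>\<^sup>3\<close>: the monomial \<open>u\<^sup>a v\<^sup>b z\<^sup>c\<close> has exponent vector \<open>(a, b, c)\<close>, and multiplication is the
  convolution product of \<^theory>\<open>HOL-Library.Poly_Mapping\<close>.
\<close>

type_synonym 'a laurent = "(int \<times> int \<times> int) \<Rightarrow>\<^sub>0 'a"

definition const :: "'a::comm_ring_1 \<Rightarrow> 'a laurent" where
  "const c = Poly_Mapping.single 0 c"

definition var_u :: "'a::comm_ring_1 laurent" where
  "var_u = Poly_Mapping.single (1, 0, 0) 1"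

definition var_v :: "'a::comm_ring_1 laurent" where
  "var_v = Poly_Mapping.single (0, 1, 0) 1"

definition var_z :: "'a::comm_ring_1 laurent" where
  "var_z = Poly_Mapping.single (0, 0, 1) 1"

definition derivation :: "('a::comm_ring_1 laurent \<Rightarrow> 'a laurent) \<Rightarrow> bool" where
  "derivation D \<longleftrightarrow>
     (\<forall>f g. D (f + g) = D f + D g) \<and>
     (\<forall>c f. D (const c * f) = const c * D f) \<and>
     (\<forall>f g. D (f * g) = D f * g + f * D g)"


section \<open>Rooted trees\<close>

text \<open>
  Simple graphs are given by their edges, which are two-element sets of vertices.  The predicate
  \<open>tree\<close> of the AFP entry Graph\_Theory is not suitable: there the walk \<open>a, b, a\<close> counts as a
  cycle, so no symmetric digraph with an arc satisfies it.
\<close>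

definition walk :: "'v set set \<Rightarrow> 'v list \<Rightarrow> bool" where
  "walk E p \<longleftrightarrow> p \<noteq> [] \<and> successively (\<lambda>x y. {x, y} \<in> E) p"

definition path :: "'v set set \<Rightarrow> 'v \<Rightarrow> 'v list \<Rightarrow> 'v \<Rightarrow> bool" where
  "path E x p y \<longleftrightarrow> walk E p \<and> distinct p \<and> hd p = x \<and> last p = y"

text \<open>The list of a cycle does not repeat the starting vertex at the end.\<close>

definition cycle :: "'v set set \<Rightarrow> 'v list \<Rightarrow> bool" where
  "cycle E p \<longleftrightarrow> walk E p \<and> distinct p \<and> length p \<ge> 3 \<and> {last p, hd p} \<in> E"

definition tree :: "'v set \<Rightarrow> 'v set set \<Rightarrow> bool" where
  "tree V E \<longleftrightarrow>
     V \<noteq> {} \<and> (\<forall>e\<in>E. e \<subseteq> V \<and> card e = 2) \<and>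
     (\<forall>x\<in>V. \<forall>y\<in>V. \<exists>p. walk E p \<and> hd p = x \<and> last p = y) \<and>
     (\<nexists>p. cycle E p)"

definition rooted_tree :: "'v set \<Rightarrow> 'v \<times> 'v set set \<Rightarrow> bool" where
  "rooted_tree V = (\<lambda>(r, E). tree V E \<and> r \<in> V)"

text \<open>The descendants of \<open>j\<close>, including \<open>j\<close> itself: \<open>j\<close> lies on the path from the root to them.\<close>

definition descendants :: "'v \<times> 'v set set \<Rightarrow> 'v \<Rightarrow> 'v set" where
  "descendants = (\<lambda>(r, E) j. {d. \<exists>p. path E r p d \<and> j \<in> set p})"

text \<open>The edges as pairs \<open>(i, j)\<close> with \<open>j\<close> a child of \<open>i\<close>.\<close>

definition child_edges :: "'v \<times> 'v set set \<Rightarrow> ('v \<times> 'v) set" where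
  "child_edges T = {(i, j). {i, j} \<in> snd T \<and> j \<in> descendants T i}"

definition improper_edges :: "nat \<times> nat set set \<Rightarrow> (nat \<times> nat) set" where
  "improper_edges T = {(i, j) \<in> child_edges T. \<exists>d\<in>descendants T j. d < i}"

definition R :: "nat \<Rightarrow> nat \<Rightarrow> nat" where
  "R n k = card {T. rooted_tree {1..n} T \<and> card (improper_edges T) = k}"

definition R_poly :: "nat \<Rightarrow> 'b::comm_semiring_1 \<Rightarrow> 'b" where
  "R_poly n x = (\<Sum>k = 0..n - 1. of_nat (R n k) * x ^ k)"


section \<open>The grammar determines a unique derivation\<close>

definition euler_op :: "(int \<times> int \<times> int \<Rightarrow> int) \<Rightarrow> 'a::comm_ring_1 laurent \<Rightarrow> 'a laurent" where
  "euler_op w = Poly_Mapping.mapp (\<lambda>k x. of_int (w k) * x)"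

lemma lookup_euler_op:
  "Poly_Mapping.lookup (euler_op w f) k = of_int (w k) * Poly_Mapping.lookup f k"
  by (simp add: euler_op_def lookup_mapp when_def in_keys_iff)

lemma euler_op_add: "euler_op w (f + g) = euler_op w f + euler_op w g"
  by (rule poly_mapping_eqI) (simp add: lookup_euler_op lookup_add algebra_simps)

lemma euler_op_single:
  "euler_op w (Poly_Mapping.single k x) = Poly_Mapping.single k (of_int (w k) * x)"
  by (rule poly_mapping_eqI) (simp add: lookup_euler_op lookup_single when_def)

lemma laurent_induct [case_names single add]:
  fixes f :: "'k \<Rightarrow>\<^sub>0 'a::comm_ring_1"
  assumes s: "\<And>k x. P (Poly_Mapping.single k x)"
    and a: "\<And>f g. P f \<Longrightarrow> P g \<Longrightarrow> P (f + g)"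
  shows "P f"
proof (induction f rule: update_induct)
  case const
  show ?case using s[of undefined 0] by simp
next
  case (update f k x)
  have "Poly_Mapping.update k x f = f + Poly_Mapping.single k x"
    using update(1)
    by (intro poly_mapping_eqI) (auto simp: lookup_update lookup_add lookup_single when_def in_keys_iff)
  then show ?case using a[OF update(3) s] by simp
qed

lemma euler_op_mult:
  assumes w: "\<And>k l. w (k + l) = w k + w l"
  shows "euler_op w (f * g) = euler_op w f * g + f * euler_op w g"
proof (induction f rule: laurent_induct)
  case (single k x)
  show ?case
    by (induction g rule: laurent_induct)
      (simp_all add: mult_single euler_op_single euler_op_add w single_add[symmetric] algebra_simps)
next
  case (add f1 f2)
  then show ?case by (simp add: euler_op_add algebra_simps)
qed

definition grammar_derivation :: "('a::comm_ring_1 laurent \<Rightarrow> 'a laurent) \<Rightarrow> bool" where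
  "grammar_derivation D \<longleftrightarrow> derivation D \<and> D var_z = var_v * var_z ^ 2 \<and>
     D var_v = var_u * var_v ^ 2 * var_z \<and> D var_u = var_u ^ 2 * var_v * var_z"

lemma const_zero_weight:
  assumes w: "\<And>k l. w (k + l) = w k + w l"
  shows "euler_op w (const c) = 0"
proof -
  have "w 0 = 0" using w[of 0 0] by simp
  then show ?thesis by (simp add: const_def euler_op_single)
qed

lemma grammar_derivation_exists:
  "\<exists>D :: 'a::comm_ring_1 laurent \<Rightarrow> 'a laurent. grammar_derivation D"
proof -
  define w1 w2 :: "int \<times> int \<times> int \<Rightarrow> int"
    where "w1 = (\<lambda>(a, b, c). a + b)" and "w2 = (\<lambda>(a, b, c). c)"
  have w1: "w1 (k + l) = w1 k + w1 l" and w2: "w2 (k + l) = w2 k + w2 l" for k l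
    by (simp_all add: w1_def w2_def case_prod_beta)
  define D :: "'a laurent \<Rightarrow> 'a laurent"
    where "D f = var_u * var_v * var_z * euler_op w1 f + var_v * var_z * euler_op w2 f" for f
  have "derivation D"
    unfolding derivation_def D_def
    by (simp add: euler_op_add euler_op_mult[OF w1] euler_op_mult[OF w2]
        const_zero_weight[OF w1] const_zero_weight[OF w2] algebra_simps)
  moreover have "D var_z = var_v * var_z ^ 2" "D var_v = var_u * var_v ^ 2 * var_z"
    "D var_u = var_u ^ 2 * var_v * var_z"
    by (simp_all add: D_def var_u_def var_v_def var_z_def euler_op_single w1_def w2_def
        mult_single power2_eq_square)
  ultimately show ?thesis
    unfolding grammar_derivation_def by blast
qed

lemma grammar_derivation_unique:
  fixes D D' :: "'a::comm_ring_1 laurent \<Rightarrow> 'a laurent"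
  assumes D: "grammar_derivation D" and D': "grammar_derivation D'"
  shows "D = D'"
proof -
  let ?m = "\<lambda>k. Poly_Mapping.single k 1 :: 'a laurent"
  define d where "d f = D f - D' f" for f
  have d_plus: "d (f + g) = d f + d g" for f g
    using D D' unfolding grammar_derivation_def derivation_def d_def by simp
  have scale: "d (const c * f) = const c * d f" for c f
  proof -
    have "D (const c * f) = const c * D f" "D' (const c * f) = const c * D' f"
      using D D' unfolding grammar_derivation_def derivation_def by blast+
    then show ?thesis by (simp add: d_def right_diff_distrib)
  qed
  have mult: "d (f * g) = d f * g + f * d g" for f g
    using D D' unfolding grammar_derivation_def derivation_def d_def by (simp add: algebra_simps)
  have gens: "d (?m (1, 0, 0)) = 0" "d (?m (0, 1, 0)) = 0" "d (?m (0, 0, 1)) = 0"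
    using D D' unfolding grammar_derivation_def d_def var_u_def var_v_def var_z_def by simp_all
  have m_add: "?m (k + l) = ?m k * ?m l" for k l
    by (simp add: mult_single)
  have m0: "?m 0 = 1" by simp
  have d1: "d 1 = 0" using mult[of 1 1] by simp
  have d_add: "d (?m (k + l)) = 0" if "d (?m k) = 0" "d (?m l) = 0" for k l
    using that by (simp only: m_add mult) simp
  have d_neg: "d (?m (- k)) = 0" if "d (?m k) = 0" for k
  proof -
    have "?m k * ?m (- k) = 1" by (simp add: mult_single)
    then have "0 = d (?m k * ?m (- k))" using d1 by simp
    then have "?m k * d (?m (- k)) = 0" using that by (simp add: mult)
    then have "?m (- k) * (?m k * d (?m (- k))) = 0" by simp
    then have "(?m (- k) * ?m k) * d (?m (- k)) = 0" by (simp only: mult.assoc)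
    then show ?thesis by (simp add: mult_single)
  qed
  have pow: "d (?m (h i)) = 0"
    if h: "\<And>i j. h (i + j) = h i + h j" and 1: "d (?m (h 1)) = 0" for h :: "int \<Rightarrow> _" and i
  proof -
    have h0: "h 0 = 0" using h[of 0 0] by simp
    have hm: "h (- 1) = - h 1" using h[of 1 "- 1"] h0 by (simp add: eq_neg_iff_add_eq_0 add.commute)
    show ?thesis
    proof (induction i rule: int_induct[where k = 0])
      case base
      show ?case using d1 m0 by (simp add: h0)
    next
      case (step1 i)
      then show ?case using d_add[OF _ 1] by (simp add: h)
    next
      case (step2 i)
      have "h (i - 1) = h i + (- h 1)" using h[of i "- 1"] hm by simp
      then show ?case using d_add[OF step2(2) d_neg[OF 1]] by simp
    qed
  qed
  have mono: "d (?m k) = 0" for k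
  proof (cases k)
    case (fields a b c)
    have "d (?m (a, 0, 0)) = 0"
      by (rule pow[of "\<lambda>a. (a, 0, 0)"]) (simp_all add: gens)
    moreover have "d (?m (0, b, 0)) = 0"
      by (rule pow[of "\<lambda>b. (0, b, 0)"]) (simp_all add: gens)
    moreover have "d (?m (0, 0, c)) = 0"
      by (rule pow[of "\<lambda>c. (0, 0, c)"]) (simp_all add: gens)
    ultimately have "d (?m ((a, 0, 0) + ((0, b, 0) + (0, 0, c)))) = 0"
      by (rule d_add[OF _ d_add])
    then show ?thesis by (simp add: fields)
  qed
  have "d f = 0" for f
  proof (induction f rule: laurent_induct)
    case (single k x)
    have "Poly_Mapping.single k x = const x * ?m k" by (simp add: const_def mult_single)
    then show ?case by (simp add: scale mono)
  next
    case (add f g)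
    then show ?case by (simp add: d_plus)
  qed
  then show ?thesis by (simp add: d_def fun_eq_iff)
qed

theorem grammar_derivation_ex1:
  "\<exists>!D :: 'a::comm_ring_1 laurent \<Rightarrow> 'a laurent. grammar_derivation D"
  using grammar_derivation_exists grammar_derivation_unique by blast

lemma finite_rooted_trees:
  assumes "finite V"
  shows "finite {T. rooted_tree V T}"
proof (rule finite_subset)
  show "{T. rooted_tree V T} \<subseteq> V \<times> Pow (Pow V)"
    by (auto simp: rooted_tree_def tree_def)
qed (use assms in simp)

end

theory Submission
  imports Defs
begin

text \<open>
  Since \<open>D (u\<^sup>k v\<^sup>n z\<^sup>n) = v\<^sup>n\<^sup>+\<^sup>1 z\<^sup>n\<^sup>+\<^sup>1 (n u\<^sup>k + (n + k) u\<^sup>k\<^sup>+\<^sup>1)\<close>, it is enough that each rooted tree \<open>T\<close> on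
  \<open>[n]\<close> with \<open>k\<close> improper edges gives rise to \<open>n\<close> trees on \<open>[n + 1]\<close> with \<open>k\<close> improper edges and
  to \<open>n + k\<close> trees with \<open>k + 1\<close> improper edges.  Write \<open>N = n + 1\<close>.  The former attach \<open>N\<close> as a leaf
  to a vertex of \<open>T\<close>.  The latter are the trees in which \<open>N\<close> is not a leaf: let \<open>i\<close> be the child of
  \<open>N\<close> whose subtree has the largest minimum, and merge \<open>N\<close> into \<open>i\<close>, so that the other children of \<open>N\<close>
  become children of \<open>i\<close>.  All edges from \<open>N\<close> are improper, and those that survive remain improper,
  so exactly one improper edge is lost.  To undo the merge one chooses \<open>i\<close> and the set \<open>S\<close> of children
  of \<open>i\<close> that move to \<open>N\<close>; the admissible \<open>S\<close> are the initial segments, ordered by the minima of the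
  subtrees, of the children of \<open>i\<close> joined to it by an improper edge.  A vertex with \<open>q\<close> improper child
  edges admits \<open>q + 1\<close> of them, which sums to \<open>n + k\<close>.
\<close>

section \<open>Rooted trees as parent maps\<close>

definition arcs :: "('v \<rightharpoonup> 'v) \<Rightarrow> ('v \<times> 'v) set" where
  "arcs f = {(i, j). f j = Some i}"

text \<open>The map sends a vertex to its parent. The condition on \<open>dom f\<close> fixes the
  map off \<open>V\<close> and at the root, so that a rooted tree is encoded by just one
  map.\<close>

definition arborescence :: "'v set \<Rightarrow> 'v \<Rightarrow> ('v \<rightharpoonup> 'v) \<Rightarrow> bool" where
  "arborescence V r f \<longleftrightarrow>
     r \<in> V \<and> dom f = V - {r} \<and> ran f \<subseteq> V \<and> (\<forall>x\<in>V. (r, x) \<in> (arcs f)\<^sup>*)"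

definition undirected :: "('v \<rightharpoonup> 'v) \<Rightarrow> 'v set set" where
  "undirected f = {{i, j} | i j. f j = Some i}"

lemma arcs_iff [simp]: "(i, j) \<in> arcs f \<longleftrightarrow> f j = Some i"
  by (simp add: arcs_def)

lemma doubleton_in_undirected:
  "{x, y} \<in> undirected f \<longleftrightarrow> f y = Some x \<or> f x = Some y"
  by (auto simp: undirected_def doubleton_eq_iff)

lemma arborescence_arc:
  assumes "arborescence V r f" "f j = Some i"
  shows "i \<in> V" "j \<in> V" "j \<noteq> r"
  using assms by (auto simp: arborescence_def ran_def dom_def)

lemma arborescence_parent:
  assumes "arborescence V r f" "x \<in> V" "x \<noteq> r"
  obtains i where "f x = Some i"
proof -
  have "x \<in> dom f" using assms by (simp add: arborescence_def)
  then show thesis using that by blast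
qed

lemma arborescence_None_iff:
  assumes "arborescence V r f"
  shows "f x = None \<longleftrightarrow> x \<notin> V \<or> x = r"
proof -
  have "dom f = V - {r}" using assms by (simp add: arborescence_def)
  then have "x \<notin> dom f \<longleftrightarrow> x \<notin> V - {r}" by simp
  then show ?thesis by (simp add: domIff)
qed

text \<open>A cycle through \<open>y\<close> runs through its only parent, so it can be pushed up
  along the path from \<open>r\<close> until it passes through \<open>r\<close>, which has no
  parent.\<close>

lemma arborescence_acyclic:
  assumes f: "arborescence V r f"
  shows "acyclic (arcs f)"
proof -
  have *: "(x, x) \<notin> (arcs f)\<^sup>+" if "(r, x) \<in> (arcs f)\<^sup>*" for x
    using that
  proof (induction rule: rtrancl_induct)
    case base
    show ?case using arborescence_arc(3)[OF f] by (metis arcs_iff tranclD2)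
  next
    case (step x y)
    show ?case
    proof
      assume "(y, y) \<in> (arcs f)\<^sup>+"
      then obtain z where z: "(y, z) \<in> (arcs f)\<^sup>*" "(z, y) \<in> arcs f" by (meson tranclD2)
      with step(2) have "z = x" by simp
      with z step show False by (meson rtrancl_into_trancl2)
    qed
  qed
  have "(x, x) \<notin> (arcs f)\<^sup>+" for x
  proof
    assume a: "(x, x) \<in> (arcs f)\<^sup>+"
    then obtain z where "(z, x) \<in> arcs f" by (meson tranclD2)
    then have "x \<in> V" using arborescence_arc[OF f] by simp
    then show False using a * f by (auto simp: arborescence_def)
  qed
  then show ?thesis by (simp add: acyclic_def)
qed

lemma arborescence_antisym:
  assumes f: "arborescence V r f" and xy: "(x, y) \<in> (arcs f)\<^sup>*" "(y, x) \<in> (arcs f)\<^sup>*"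
  shows "x = y"
  using acyclic_impl_antisym_rtrancl[OF arborescence_acyclic[OF f]] xy by (auto dest: antisymD)

lemma arborescence_no_loop:
  assumes "arborescence V r f"
  shows "f x \<noteq> Some x"
proof
  assume "f x = Some x"
  then have "(x, x) \<in> (arcs f)\<^sup>+" by auto
  then show False using arborescence_acyclic[OF assms] by (auto simp: acyclic_def)
qed

section \<open>Walks, paths and cycles in the underlying undirected graph\<close>

lemma rtrancl_imp_walk:
  assumes "(x, y) \<in> {(x, y). {x, y} \<in> E}\<^sup>*"
  shows "\<exists>p. walk E p \<and> hd p = x \<and> last p = y"
  using assms
proof (induction rule: rtrancl_induct)
  case base
  show ?case by (rule exI[of _ "[x]"]) (simp add: walk_def)
next
  case (step y z)
  then obtain p where "walk E p" "hd p = x" "last p = y" by blast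
  with step(2) show ?case
    by (intro exI[of _ "p @ [z]"]) (auto simp: walk_def successively_append_iff)
qed

text \<open>Under the transitive closure of \<open>A\<close> every earlier entry is related to every
  later one, so a repeated entry would lie on a cycle of \<open>A\<close>.\<close>

lemma successively_acyclic_distinct:
  assumes "acyclic A" "successively (\<lambda>x y. (x, y) \<in> A) p"
  shows "distinct p"
proof -
  have "successively (\<lambda>x y. (x, y) \<in> A\<^sup>+) p"
    using assms(2) by (rule successively_mono) auto
  then have "sorted_wrt (\<lambda>x y. (x, y) \<in> A\<^sup>+) p"
    by (subst (asm) successively_conv_sorted_wrt) (auto simp: transp_def)
  then show ?thesis
    using assms(1) by (induction p) (auto simp: acyclic_def)
qed

lemma successively_imp_rtrancl:
  assumes "successively (\<lambda>x y. (x, y) \<in> A) p" "p \<noteq> []"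
  shows "(hd p, last p) \<in> A\<^sup>*"
  using assms
proof (induction p rule: rev_induct)
  case (snoc x p)
  then show ?case by (cases "p = []") (auto simp: successively_append_iff intro: rtrancl_into_rtrancl)
qed simp

text \<open>A path from the root never climbs: from a vertex other than \<open>r\<close> a step up
  would return to the parent just visited, against distinctness, and \<open>r\<close> has no parent.
  Conversely, a downward chain is distinct by acyclicity.\<close>

lemma path_undirected_iff:
  assumes f: "arborescence V r f"
  shows "path (undirected f) r p d \<longleftrightarrow>
    p \<noteq> [] \<and> hd p = r \<and> last p = d \<and> successively (\<lambda>x y. (x, y) \<in> arcs f) p"
proof
  assume "path (undirected f) r p d"
  then show "p \<noteq> [] \<and> hd p = r \<and> last p = d \<and> successively (\<lambda>x y. (x, y) \<in> arcs f) p"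
  proof (induction p arbitrary: d rule: rev_induct)
    case Nil
    then show ?case by (simp add: path_def walk_def)
  next
    case (snoc y p)
    show ?case
    proof (cases "p = []")
      case True
      then show ?thesis using snoc.prems by (auto simp: path_def)
    next
      case False
      then obtain q x where p: "p = q @ [x]" by (meson rev_exhaust)
      from snoc.prems False have "path (undirected f) r p x" and e: "{x, y} \<in> undirected f"
        and y: "y \<notin> set p" "d = y"
        by (auto simp: path_def walk_def successively_append_iff p hd_append split: if_splits)
      from snoc.IH[OF this(1)] have IH: "hd p = r" "successively (\<lambda>x y. (x, y) \<in> arcs f) p"
        by auto
      have "f x \<noteq> Some y"
      proof
        assume a: "f x = Some y"
        show False
        proof (cases "q = []")
          case True
          then show False using IH a arborescence_arc(3)[OF f a] by (simp add: p)
        next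
          case False
          then have "f x = Some (last q)" using IH by (simp add: p successively_append_iff)
          then show False using a y False by (auto simp: p)
        qed
      qed
      then show ?thesis using e IH y by (auto simp: successively_append_iff p doubleton_in_undirected hd_append)
    qed
  qed
next
  assume p: "p \<noteq> [] \<and> hd p = r \<and> last p = d \<and> successively (\<lambda>x y. (x, y) \<in> arcs f) p"
  then have "successively (\<lambda>x y. {x, y} \<in> undirected f) p"
    by (auto intro: successively_mono simp: doubleton_in_undirected)
  then show "path (undirected f) r p d"
    using p successively_acyclic_distinct[OF arborescence_acyclic[OF f]]
    by (simp add: path_def walk_def)
qed

lemma descendants_undirected:
  assumes f: "arborescence V r f" and j: "j \<in> V"
  shows "descendants (r, undirected f) j = {d. (j, d) \<in> (arcs f)\<^sup>*}"
proof -
  let ?chain = "\<lambda>p d. p \<noteq> [] \<and> hd p = r \<and> last p = d \<and> successively (\<lambda>x y. (x, y) \<in> arcs f) p"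
  have "(j, d) \<in> (arcs f)\<^sup>*" if p: "?chain p d" "j \<in> set p" for p d
  proof -
    obtain a b where ab: "p = a @ j # b" using split_list p(2) by metis
    then show ?thesis
      using successively_imp_rtrancl[of "arcs f" "j # b"] p(1)
      by (auto simp: successively_append_iff)
  qed
  moreover have "\<exists>p. ?chain p d \<and> j \<in> set p" if "(j, d) \<in> (arcs f)\<^sup>*" for d
    using that
  proof (induction rule: rtrancl_induct)
    case base
    have "(r, j) \<in> (arcs f)\<^sup>*" using f j by (simp add: arborescence_def)
    then have "\<exists>p. ?chain p j"
    proof (induction rule: rtrancl_induct)
      case base
      show ?case by (rule exI[of _ "[r]"]) simp
    next
      case (step y z)
      then obtain p where "?chain p y" by blast
      with step(2) show ?case
        by (intro exI[of _ "p @ [z]"]) (auto simp: successively_append_iff)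
    qed
    then show ?case using last_in_set by metis
  next
    case (step y z)
    then obtain p where "?chain p y" "j \<in> set p" by blast
    with step(2) show ?case
      by (intro exI[of _ "p @ [z]"]) (auto simp: successively_append_iff)
  qed
  ultimately show ?thesis
    by (simp add: descendants_def path_undirected_iff[OF f]) blast
qed

lemma child_edges_undirected:
  assumes f: "arborescence V r f"
  shows "child_edges (r, undirected f) = arcs f"
proof -
  have "(i, j) \<in> child_edges (r, undirected f) \<longleftrightarrow> f j = Some i" for i j
  proof
    assume a: "(i, j) \<in> child_edges (r, undirected f)"
    then have e: "f j = Some i \<or> f i = Some j"
      by (simp add: child_edges_def doubleton_in_undirected)
    then have "i \<in> V" using arborescence_arc[OF f] by auto
    then have d: "(i, j) \<in> (arcs f)\<^sup>*"
      using a by (simp add: child_edges_def descendants_undirected[OF f])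
    from e show "f j = Some i"
    proof
      assume ji: "f i = Some j"
      then have "(j, i) \<in> (arcs f)\<^sup>*" by auto
      then have "i = j" using arborescence_antisym[OF f d] by simp
      then show ?thesis using ji by simp
    qed
  next
    assume a: "f j = Some i"
    then have "i \<in> V" using arborescence_arc[OF f] by auto
    then show "(i, j) \<in> child_edges (r, undirected f)"
      using a by (auto simp: child_edges_def doubleton_in_undirected descendants_undirected[OF f])
  qed
  then show ?thesis by auto
qed

text \<open>Allows a cycle to be read from any of its vertices, as the proof of
  \<open>tree_undirected\<close> requires.\<close>

lemma cycle_rotate:
  assumes "cycle E p"
  shows "cycle E (rotate k p)"
proof -
  have *: "cycle E (rotate1 p)" if c: "cycle E p" for p
  proof -
    obtain x q where p: "p = x # q" using c by (cases p) (auto simp: cycle_def walk_def)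
    have q: "q \<noteq> []" using c by (auto simp: p cycle_def)
    show ?thesis using c q
      by (auto simp: p cycle_def walk_def successively_append_iff successively_Cons)
  qed
  show ?thesis
    by (induction k) (simp_all add: assms *)
qed

lemma tree_undirected:
  assumes f: "arborescence V r f" and V: "finite V"
  shows "tree V (undirected f)"
  unfolding tree_def
proof (intro conjI ballI notI)
  show "V = {} \<Longrightarrow> False" using f by (auto simp: arborescence_def)
next
  fix e assume "e \<in> undirected f"
  then obtain i j where e: "e = {i, j}" "f j = Some i" by (auto simp: undirected_def)
  then show "e \<subseteq> V" using arborescence_arc[OF f] by auto
  have "(i, j) \<in> (arcs f)\<^sup>+" using e by auto
  then have "i \<noteq> j" using arborescence_acyclic[OF f] by (auto simp: acyclic_def)
  then show "card e = 2" by (simp add: e)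
next
  fix x y assume xy: "x \<in> V" "y \<in> V"
  let ?S = "{(x, y). {x, y} \<in> undirected f}"
  have sub: "(arcs f)\<^sup>* \<subseteq> ?S\<^sup>*"
    by (rule rtrancl_mono) (auto simp: doubleton_in_undirected)
  have "sym ?S" by (auto simp: sym_def insert_commute)
  then have "sym (?S\<^sup>*)" by (rule sym_rtrancl)
  then have "(x, r) \<in> ?S\<^sup>*" "(r, y) \<in> ?S\<^sup>*"
    using xy f sub by (auto simp: arborescence_def dest: symD)
  then have "(x, y) \<in> ?S\<^sup>*" by (rule rtrancl_trans)
  then show "\<exists>p. walk (undirected f) p \<and> hd p = x \<and> last p = y" by (rule rtrancl_imp_walk)
next
  assume "\<exists>p. cycle (undirected f) p"
  then obtain p where p: "cycle (undirected f) p" by blast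
  \<comment> \<open>Well-foundedness yields a vertex \<open>x\<close> of the cycle none of whose
    children is on the cycle. Both neighbours of \<open>x\<close> on the cycle would then be its
    parent, but they are distinct.\<close>
  have "arcs f \<subseteq> V \<times> V" using arborescence_arc[OF f] by auto
  then have "finite (arcs f)" using V by (simp add: finite_subset)
  then have "wf ((arcs f)\<inverse>)" using arborescence_acyclic[OF f] by (simp add: finite_acyclic_wf_converse)
  moreover have "hd p \<in> set p" using p by (simp add: cycle_def walk_def)
  ultimately obtain x where x: "x \<in> set p" "\<And>y. (y, x) \<in> (arcs f)\<inverse> \<Longrightarrow> y \<notin> set p"
    by (metis wfE_min)
  from x(1) obtain k where k: "k < length p" "p ! k = x" by (auto simp: in_set_conv_nth)
  define q where "q = rotate k p"
  have q: "cycle (undirected f) q" "set q = set p" "hd q = x"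
    using cycle_rotate[OF p] k hd_rotate_conv_nth[of p k] by (simp_all add: q_def) fastforce
  from q obtain q' where q': "q = x # q'" by (cases q) (auto simp: cycle_def walk_def)
  have len: "length q' \<ge> 2" "distinct q'" "q' \<noteq> []" using q by (auto simp: q' cycle_def)
  then have ne: "hd q' \<noteq> last q'"
    by (cases q') (auto simp: Suc_le_eq split: if_splits)
  have "{x, hd q'} \<in> undirected f" "{last q', x} \<in> undirected f"
    using q len by (auto simp: q' cycle_def walk_def successively_Cons)
  moreover have "f (hd q') \<noteq> Some x" "f (last q') \<noteq> Some x"
    using x(2) q(2) len by (auto simp: q' dest: hd_in_set last_in_set)
  ultimately show False using ne by (auto simp: doubleton_in_undirected)
qed

section \<open>Unique paths and the parent map of a tree\<close>

lemma walk_imp_path: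
  assumes "walk E p"
  shows "\<exists>q. path E (hd p) q (last p)"
  using assms
proof (induction "length p" arbitrary: p rule: less_induct)
  case less
  show ?case
  proof (cases "distinct p")
    case True
    then show ?thesis using less.prems by (auto simp: path_def)
  next
    case False
    then obtain a b c y where p: "p = a @ [y] @ b @ [y] @ c" using not_distinct_decomp by blast
    let ?q = "a @ [y] @ c"
    have "walk E ?q" using less.prems
      by (auto simp: p walk_def successively_append_iff successively_Cons)
    from less.hyps[OF _ this] show ?thesis
      by (auto simp: p hd_append split: if_splits)
  qed
qed

text \<open>The cycle goes out along \<open>a\<close> and returns along \<open>b\<close>. If both
  were empty, the two paths would be the same edge and the list would have only two
  vertices.\<close>

lemma two_paths_cycle:
  assumes "walk E (x # a @ [z])" "walk E (x # b @ [z])" "distinct (x # a @ [z])"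
    "distinct (x # b @ [z])" "set a \<inter> set b = {}" "a \<noteq> [] \<or> b \<noteq> []"
  shows "cycle E (x # a @ z # rev b)"
proof -
  have "successively (\<lambda>x y. {x, y} \<in> E) (rev (x # b @ [z]))"
    using assms(2) by (subst successively_rev) (simp add: walk_def insert_commute)
  then have "successively (\<lambda>x y. {x, y} \<in> E) ((z # rev b) @ [x])"
    by simp
  then have "successively (\<lambda>x y. {x, y} \<in> E) (z # rev b)" "{last (z # rev b), x} \<in> E"
    unfolding successively_append_iff by simp_all
  moreover have "length (x # a @ z # rev b) \<ge> 3"
    using assms(6) by (cases a; cases b) auto
  ultimately show ?thesis
    using assms by (auto simp: cycle_def walk_def successively_append_iff successively_Cons hd_append)
qed

lemma path_unique:
  assumes E: "\<nexists>p. cycle E p" and "path E x p y" "path E x q y"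
  shows "p = q"
  using assms(2-)
proof (induction p arbitrary: x q)
  case Nil
  then show ?case by (simp add: path_def walk_def)
next
  case (Cons x' p)
  then have x': "x' = x" by (simp add: path_def)
  obtain q' where q: "q = x # q'" using Cons.prems(2) by (cases q) (auto simp: path_def walk_def)
  show ?case
  proof (cases "p = [] \<or> q' = []")
    case True
    moreover have "x \<notin> set p" "x \<notin> set q'" "last (x # p) = last (x # q')"
      using Cons.prems by (auto simp: path_def x' q)
    ultimately have "p = []" "q' = []"
      using last_in_set[of p] last_in_set[of q'] by (metis last.simps)+
    then show ?thesis by (simp add: x' q)
  next
    case False
    then have last: "last p = y" "last q' = y" using Cons.prems by (auto simp: path_def q)
    show ?thesis
    proof (cases "hd p = hd q'")
      case True
      have "path E (hd p) p y" "path E (hd p) q' y"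
        using Cons.prems False True by (auto simp: path_def walk_def x' q successively_Cons)
      then show ?thesis using Cons.IH by (simp add: x' q)
    next
      case neq: False
      have "y \<in> set p" "y \<in> set q'" using last False last_in_set[of p] last_in_set[of q'] by auto
      then have "\<exists>z\<in>set p. z \<in> set q'" by blast
      \<comment> \<open>Here \<open>z\<close> is the first vertex of \<open>p\<close> that also lies
        on \<open>q'\<close>, so the segments \<open>a\<close> and \<open>b\<close> before it are
        disjoint. They are not both empty because \<open>p\<close> and \<open>q'\<close> start
        differently.\<close>
      then obtain a z a' where p: "p = a @ z # a'" "z \<in> set q'" "\<forall>w\<in>set a. w \<notin> set q'"
        using split_list_first_prop[of p "\<lambda>z. z \<in> set q'"] by blast
      then obtain b b' where q': "q' = b @ z # b'" using split_list[of z q'] by blast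
      have "cycle E (x # a @ z # rev b)"
      proof (rule two_paths_cycle)
        show "walk E (x # a @ [z])" "walk E (x # b @ [z])"
          using Cons.prems
          by (auto simp: path_def walk_def x' q q' p(1) successively_append_iff successively_Cons hd_append split: if_splits)
        show "distinct (x # a @ [z])" "distinct (x # b @ [z])"
          using Cons.prems by (auto simp: path_def x' q q' p(1))
        show "set a \<inter> set b = {}" using p(3) by (auto simp: q')
        show "a \<noteq> [] \<or> b \<noteq> []" using neq by (auto simp: p(1) q')
      qed
      then show ?thesis using E by blast
    qed
  qed
qed

text \<open>The parent of \<open>y\<close> is the last vertex but one on the unique path from
  \<open>r\<close> to \<open>y\<close>.\<close>

lemma tree_imp_arborescence:
  assumes t: "tree V E" and r: "r \<in> V"
  obtains f where "arborescence V r f" "undirected f = E"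
proof -
  have cyc: "\<nexists>p. cycle E p" and ne: "\<And>x y. {x, y} \<in> E \<Longrightarrow> x \<in> V \<and> y \<in> V \<and> x \<noteq> y"
    and e2: "\<And>e. e \<in> E \<Longrightarrow> card e = 2"
    using t by (fastforce simp: tree_def)+
  note uniq = path_unique[OF cyc]
  define P where "P y = (THE p. path E r p y)" for y
  have PI: "P y = p" if "path E r p y" for p y
    unfolding P_def using that uniq by (intro the_equality) auto
  have P: "path E r (P y) y" if y: "y \<in> V" for y
  proof -
    obtain p where "walk E p" "hd p = r" "last p = y" using t r y unfolding tree_def by meson
    then obtain q where "path E r q y" using walk_imp_path by metis
    then show ?thesis using PI by simp
  qed
  define f where "f y = (if y \<in> V - {r} then Some (last (butlast (P y))) else None)" for y
  have fI: "f y = Some x \<and> {x, y} \<in> E" if p: "path E r (p @ [y]) y" "p \<noteq> []" "last p = x" for p x y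
  proof -
    have e: "{x, y} \<in> E" using p by (auto simp: path_def walk_def successively_append_iff)
    have "r \<in> set p" using p(1,2) by (auto simp: path_def)
    then have "y \<noteq> r" using p(1) by (auto simp: path_def)
    then show ?thesis using ne[OF e] PI[OF p(1)] p(3) e by (simp add: f_def)
  qed
  have fE: "\<exists>x. f y = Some x \<and> {x, y} \<in> E" if y: "y \<in> V" "y \<noteq> r" for y
  proof -
    have "P y \<noteq> []" "last (P y) = y" "hd (P y) = r" using P[OF y(1)] by (auto simp: path_def walk_def)
    then obtain p where p: "P y = p @ [y]" by (metis append_butlast_last_id)
    then have "p \<noteq> []" using \<open>hd (P y) = r\<close> y(2) by auto
    then show ?thesis using fI[of p y] P[OF y(1)] p by auto
  qed
  have fD: "{x, y} \<in> E" if "f y = Some x" for x y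
    using that fE[of y] by (auto simp: f_def split: if_splits)
  have step: "f j = Some i" if ij: "{i, j} \<in> E" "j \<notin> set (P i)" for i j
  proof -
    have "path E r (P i @ [j]) j" "P i \<noteq> []" "last (P i) = i"
      using P[of i] ne[OF ij(1)] ij by (auto simp: path_def walk_def successively_append_iff)
    then show ?thesis using fI by blast
  qed
  have "undirected f = E"
  proof
    show "undirected f \<subseteq> E" using fD by (auto simp: undirected_def)
    show "E \<subseteq> undirected f"
    proof
      fix e assume e: "e \<in> E"
      then obtain i j where ij: "e = {i, j}" using e2 by (metis card_2_iff)
      have "f j = Some i \<or> f i = Some j"
      proof (cases "j \<in> set (P i)")
        case True
        then obtain a b where ab: "P i = a @ j # b" by (metis split_list)
        have iV: "i \<in> V" "i \<noteq> j" using ne e ij by auto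
        then have "b \<noteq> []" using P[OF iV(1)] by (auto simp: ab path_def)
        \<comment> \<open>The path to \<open>j\<close> is the part of \<open>P i\<close> up to
          \<open>j\<close>. It avoids \<open>i\<close>, so \<open>step\<close> applies with the two
          ends exchanged.\<close>
        have "path E r (a @ [j]) j"
          using P[OF iV(1)] by (auto simp: ab path_def walk_def successively_append_iff hd_append)
        then have "P j = a @ [j]" by (rule PI)
        moreover have "i \<in> set b" using P[OF iV(1)] \<open>b \<noteq> []\<close> by (auto simp: ab path_def)
        ultimately have "i \<notin> set (P j)" using P[OF iV(1)] by (auto simp: ab path_def)
        then show ?thesis using step[of j i] e ij by (simp add: insert_commute)
      next
        case False
        then show ?thesis using step e ij by blast
      qed
      then show "e \<in> undirected f" by (simp add: ij doubleton_in_undirected)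
    qed
  qed
  moreover have "(r, y) \<in> (arcs f)\<^sup>*" if "path E r p y" for p y
    using that
  proof (induction p arbitrary: y rule: rev_induct)
    case Nil
    then show ?case by (simp add: path_def walk_def)
  next
    case (snoc y' p)
    then have y': "y' = y" by (simp add: path_def)
    show ?case
    proof (cases "p = []")
      case True
      then show ?thesis using snoc.prems by (auto simp: path_def)
    next
      case False
      then have "path E r p (last p)"
        using snoc.prems by (auto simp: path_def walk_def successively_append_iff)
      then have "(r, last p) \<in> (arcs f)\<^sup>*" by (rule snoc.IH)
      moreover have "f y = Some (last p)" using fI False snoc.prems y' by blast
      ultimately show ?thesis by (auto intro: rtrancl_into_rtrancl)
    qed
  qed
  then have "\<forall>y\<in>V. (r, y) \<in> (arcs f)\<^sup>*" using P by blast
  moreover have "dom f = V - {r}" by (auto simp: f_def dom_def)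
  moreover have "ran f \<subseteq> V" using fD ne by (auto simp: ran_def)
  ultimately show thesis using that r by (auto simp: arborescence_def)
qed

section \<open>Subtrees and improper children\<close>

definition subtree :: "('v \<rightharpoonup> 'v) \<Rightarrow> 'v \<Rightarrow> 'v set" where
  "subtree f x = {d. (x, d) \<in> (arcs f)\<^sup>*}"

text \<open>An edge from \<open>i\<close> to \<open>j\<close> is improper exactly if this minimum
  for \<open>j\<close> is below \<open>i\<close>; the minima also serve to order siblings.\<close>

definition min_label :: "('v::linorder \<rightharpoonup> 'v) \<Rightarrow> 'v \<Rightarrow> 'v" where
  "min_label f x = Min (subtree f x)"

text \<open>An edge is recorded by its lower end, which determines it, so improper edges are counted
  as vertices.\<close>

definition improper_children :: "('v::linorder \<rightharpoonup> 'v) \<Rightarrow> 'v set" where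
  "improper_children f = {j. \<exists>i. f j = Some i \<and> min_label f j < i}"

definition arborescences :: "'v set \<Rightarrow> ('v \<rightharpoonup> 'v) set" where
  "arborescences V = {f. \<exists>r. arborescence V r f}"

lemma subtree_refl [simp]: "x \<in> subtree f x"
  by (simp add: subtree_def)

lemma subtree_trans: "y \<in> subtree f x \<Longrightarrow> subtree f y \<subseteq> subtree f x"
  by (auto simp: subtree_def)

lemma subtree_subset:
  assumes "arborescence V r f" "x \<in> V"
  shows "subtree f x \<subseteq> V"
proof
  fix d assume "d \<in> subtree f x"
  then have "(x, d) \<in> (arcs f)\<^sup>*" by (simp add: subtree_def)
  then show "d \<in> V"
    by (induction rule: rtrancl_induct) (use assms arborescence_arc in auto)
qed

lemma min_label_in:
  assumes "finite V" "arborescence V r f" "x \<in> V"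
  shows "min_label f x \<in> subtree f x"
  unfolding min_label_def
  using finite_subset[OF subtree_subset[OF assms(2,3)] assms(1)] subtree_refl[of x f]
  by (intro Min_in) blast+

lemma min_label_le:
  assumes "finite V" "arborescence V r f" "x \<in> V" "d \<in> subtree f x"
  shows "min_label f x \<le> d"
  unfolding min_label_def
  using finite_subset[OF subtree_subset[OF assms(2,3)] assms(1)] assms(4) by (intro Min_le)

lemma min_label_mono:
  assumes "finite V" "arborescence V r f" "x \<in> V" "y \<in> subtree f x"
  shows "min_label f x \<le> min_label f y"
  using assms min_label_in[of V r f y] subtree_subset[of V r f x] subtree_trans[of y f x]
  by (intro min_label_le[OF assms(1-3)]) blast

text \<open>\<open>N\<close> exceeds all labels in \<open>V\<close>, so its presence in a subtree
  cannot change the minimum. The vertices \<open>x\<close> and \<open>y\<close> may differ because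
  splitting places a subtree under another top vertex.\<close>

lemma min_label_eqI:
  assumes "finite V" "arborescence V r f" "x \<in> V" "\<And>y. y \<in> V \<Longrightarrow> y < N"
    and "subtree g y - {N} = subtree f x"
  shows "min_label g y = min_label f x"
proof -
  have fin: "finite (subtree f x)" "subtree f x \<subseteq> V"
    using subtree_subset[OF assms(2,3)] assms(1) finite_subset by auto
  show ?thesis
  proof (cases "N \<in> subtree g y")
    case True
    then have "subtree g y = insert N (subtree f x)" using assms(5) by auto
    moreover have "subtree f x \<noteq> {}" using subtree_refl[of x f] by blast
    moreover have "Min (subtree f x) < N"
      using min_label_in[OF assms(1-3)] fin(2) assms(4) by (auto simp: min_label_def)
    ultimately show ?thesis
      unfolding min_label_def using fin(1) by simp
  next
    case False
    then show ?thesis using assms(5) by (simp add: min_label_def)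
  qed
qed

text \<open>Parents are unique, so the ancestors of \<open>d\<close> form a chain.\<close>

lemma ancestors_comparable:
  assumes "(c, d) \<in> (arcs f)\<^sup>*" "(c', d) \<in> (arcs f)\<^sup>*"
  shows "(c, c') \<in> (arcs f)\<^sup>* \<or> (c', c) \<in> (arcs f)\<^sup>*"
  using assms
proof (induction rule: rtrancl_induct)
  case (step y z)
  from step.prems show ?case
  proof (cases rule: rtranclE)
    case base
    then show ?thesis using step.hyps by (auto intro: rtrancl_into_rtrancl)
  next
    case (step w)
    then show ?thesis using step.IH \<open>(y, z) \<in> arcs f\<close> by simp
  qed
qed simp

text \<open>A nontrivial descent from \<open>c\<close> to \<open>c'\<close> enters \<open>c'\<close>
  through the common parent \<open>p\<close>, which would put \<open>c\<close> on a cycle.\<close>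

lemma siblings_incomparable:
  assumes f: "arborescence V r f" and c: "f c = Some p" "f c' = Some p"
    and cc': "(c, c') \<in> (arcs f)\<^sup>*"
  shows "c = c'"
  using cc'
proof (cases rule: rtranclE)
  case (step w)
  then have cp: "(c, p) \<in> (arcs f)\<^sup>*" using c by simp
  have "(p, c) \<in> arcs f" using c by simp
  with cp have "(c, c) \<in> (arcs f)\<^sup>+" by (rule rtrancl_into_trancl1)
  then show ?thesis using arborescence_acyclic[OF f] by (auto simp: acyclic_def)
qed

text \<open>A shared minimum would be a common descendant, making one sibling an ancestor of the
  other. Hence the minima order siblings strictly.\<close>

lemma min_label_siblings:
  assumes fin: "finite V" and f: "arborescence V r f"
  shows "inj_on (min_label f) {c. f c = Some p}"
proof (rule inj_onI, simp)
  fix c c' assume c: "f c = Some p" "f c' = Some p" and eq: "min_label f c = min_label f c'"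
  have "c \<in> V" "c' \<in> V" using c arborescence_arc[OF f] by auto
  then have "min_label f c \<in> subtree f c" "min_label f c \<in> subtree f c'"
    using min_label_in[OF fin f, of c] min_label_in[OF fin f, of c'] eq by simp_all
  then have "(c, c') \<in> (arcs f)\<^sup>* \<or> (c', c) \<in> (arcs f)\<^sup>*"
    unfolding subtree_def using ancestors_comparable[of c "min_label f c" f c'] by simp
  then show "c = c'" using siblings_incomparable[OF f] c by metis
qed

lemma finite_arborescences:
  assumes "finite V"
  shows "finite (arborescences V)"
proof (rule finite_subset)
  show "arborescences V \<subseteq> (\<Union>r\<in>V. {f. dom f = V - {r} \<and> ran f \<subseteq> V})"
    by (auto simp: arborescences_def arborescence_def)
  show "finite (\<Union>r\<in>V. {f. dom f = V - {r} \<and> ran f \<subseteq> V})"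
    using assms by (intro finite_UN_I finite_set_of_finite_maps) auto
qed

section \<open>Splitting and merging a vertex\<close>

text \<open>If \<open>i\<close> is the root, then \<open>f i\<close> is \<open>None\<close> and
  \<open>N\<close> becomes the new root.\<close>

definition split_vertex :: "'v \<Rightarrow> 'v \<Rightarrow> 'v set \<Rightarrow> ('v \<rightharpoonup> 'v) \<Rightarrow> ('v \<rightharpoonup> 'v)" where
  "split_vertex N i S f x =
     (if x = N then f i else if x = i \<or> x \<in> S then Some N else f x)"

definition merge_vertex :: "'v \<Rightarrow> 'v \<Rightarrow> ('v \<rightharpoonup> 'v) \<Rightarrow> ('v \<rightharpoonup> 'v)" where
  "merge_vertex N i g x =
     (if x = N then None else if x = i then g N else if g x = Some N then Some i else g x)"

text \<open>Comparing \<open>S\<close> with all remaining children of \<open>i\<close>, and bounding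
  the minima in \<open>S\<close> by \<open>i\<close>, describes the initial segments of the improper
  children of \<open>i\<close>; the empty set is one of them.\<close>

definition initial_children :: "('v::linorder \<rightharpoonup> 'v) \<Rightarrow> 'v \<Rightarrow> 'v set \<Rightarrow> bool" where
  "initial_children f i S \<longleftrightarrow> S \<subseteq> {c. f c = Some i} \<and> (\<forall>c\<in>S. min_label f c < i) \<and>
     (\<forall>c\<in>S. \<forall>c'\<in>{c. f c = Some i} - S. min_label f c < min_label f c')"

text \<open>\<open>S\<close> may be any set of children of \<open>i\<close>; whether it is an
  initial segment is characterised later in terms of the split map. The context can thus be entered
  for a merged tree before that is known.\<close>

locale vertex_split =
  fixes V :: "'v::linorder set" and r :: 'v and f :: "'v \<rightharpoonup> 'v" and N i :: 'v and S :: "'v set"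
  assumes fin: "finite V" and arb: "arborescence V r f" and N: "\<And>x. x \<in> V \<Longrightarrow> x < N"
    and i: "i \<in> V" and S: "S \<subseteq> {c. f c = Some i}"
begin

abbreviation g :: "'v \<rightharpoonup> 'v" where "g \<equiv> split_vertex N i S f"

text \<open>In \<open>g\<close> the vertex \<open>N\<close> stands where \<open>i\<close> stood in
  \<open>f\<close>, so \<open>lift x\<close> is the vertex of \<open>g\<close> that heads the former
  subtree of \<open>x\<close>.\<close>

definition lift :: "'v \<Rightarrow> 'v" where "lift x = (if x = i then N else x)"

lemma N_notin: "N \<notin> V" using N by blast

lemma N_neq [simp]: "i \<noteq> N" "N \<noteq> i" "f x \<noteq> Some N" "f N = None" "N \<notin> S" "i \<notin> S"
proof -
  show "i \<noteq> N" "N \<noteq> i" using i N_notin by auto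
  show "f x \<noteq> Some N" for x using arborescence_arc[OF arb] N_notin by blast
  show "f N = None" using arb N_notin by (auto simp: arborescence_def dom_def)
  show "N \<notin> S" using S \<open>f N = None\<close> by auto
  have "f i \<noteq> Some i" using arborescence_no_loop[OF arb] .
  then show "i \<notin> S" using S by auto
qed

lemma no_loop [simp]: "f x \<noteq> Some x"
  using arborescence_no_loop[OF arb] .

lemma S_in_V: "c \<in> S \<Longrightarrow> c \<in> V"
  using S arborescence_arc[OF arb] by blast

lemma split_child_iff: "g c = Some N \<longleftrightarrow> c = i \<or> c \<in> S"
  by (auto simp: split_vertex_def)

lemma split_reach_lift:
  assumes "(x, y) \<in> (arcs f)\<^sup>*"
  shows "(lift x, lift y) \<in> (arcs g)\<^sup>*"
  using assms
proof (induction rule: rtrancl_induct)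
  case (step y z)
  have "(lift y, lift z) \<in> (arcs g)\<^sup>*"
  \<comment> \<open>Only an arc from \<open>i\<close> to a child outside \<open>S\<close> is
    stretched, to two arcs through \<open>N\<close> and \<open>i\<close>. Every other arc of
    \<open>f\<close> stays a single arc after lifting.\<close>
  proof (cases "y = i \<and> z \<notin> S")
    case True
    then have "(N, i) \<in> arcs g" "(i, lift z) \<in> arcs g"
      using step(2) by (auto simp: split_vertex_def lift_def)
    then have "(N, lift z) \<in> (arcs g)\<^sup>*" by (meson converse_rtrancl_into_rtrancl r_into_rtrancl)
    then show ?thesis using True by (simp add: lift_def)
  next
    case False
    then have "(lift y, lift z) \<in> arcs g"
      using step(2) S by (auto simp: split_vertex_def lift_def)
    then show ?thesis by blast
  qed
  then show ?case using step.IH by (rule rtrancl_trans[rotated])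
qed simp

text \<open>Contracting \<open>N\<close> to \<open>i\<close> maps each arc of \<open>g\<close> to an
  arc of \<open>f\<close>, except the arc from \<open>N\<close> to \<open>i\<close>, which collapses
  to a point; hence the reflexive closure in the induction step.\<close>

lemma split_reach_project:
  assumes "(x, y) \<in> (arcs g)\<^sup>*"
  shows "(if x = N then i else x, if y = N then i else y) \<in> (arcs f)\<^sup>*"
  using assms
proof (induction rule: rtrancl_induct)
  case (step y z)
  have "(if y = N then i else y, if z = N then i else z) \<in> (arcs f)\<^sup>="
    using step(2) S by (auto simp: split_vertex_def split: if_splits)
  then show ?case using step.IH by (auto intro: rtrancl_into_rtrancl)
qed simp

lemma split_reach_iff:
  assumes "x \<in> V" "y \<in> V"
  shows "(lift x, y) \<in> (arcs g)\<^sup>* \<longleftrightarrow> (x, y) \<in> (arcs f)\<^sup>*"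
proof
  assume "(lift x, y) \<in> (arcs g)\<^sup>*"
  from split_reach_project[OF this] show "(x, y) \<in> (arcs f)\<^sup>*"
    using assms N_notin by (auto simp: lift_def split: if_splits)
next
  assume "(x, y) \<in> (arcs f)\<^sup>*"
  then have "(lift x, lift y) \<in> (arcs g)\<^sup>*" by (rule split_reach_lift)
  \<comment> \<open>For \<open>y = i\<close> this is the new arc from \<open>N\<close> to
    \<open>i\<close>.\<close>
  moreover have "(lift y, y) \<in> (arcs g)\<^sup>*" by (auto simp: lift_def split_vertex_def)
  ultimately show "(lift x, y) \<in> (arcs g)\<^sup>*" by (rule rtrancl_trans)
qed

lemma split_arborescence: "arborescence (insert N V) (lift r) g"
  unfolding arborescence_def
proof (intro conjI ballI)
  note dom = arborescence_None_iff[OF arb]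
  have r: "r \<in> V" using arb by (simp add: arborescence_def)
  show "lift r \<in> insert N V" using r by (simp add: lift_def)
  have "g x = None \<longleftrightarrow> x \<notin> insert N V \<or> x = lift r" for x
    using dom[of x] dom[of i] i S S_in_V[of x] N_notin r by (auto simp: split_vertex_def lift_def)
  then show "dom g = insert N V - {lift r}" by (intro set_eqI) (simp add: domIff)
  show "ran g \<subseteq> insert N V"
    using arborescence_arc[OF arb] by (auto simp: ran_def split_vertex_def split: if_splits)
  fix x assume x: "x \<in> insert N V"
  show "(lift r, x) \<in> (arcs g)\<^sup>*"
  proof (cases "x = N")
    case True
    then show ?thesis using split_reach_lift[of r i] arb i by (auto simp: arborescence_def lift_def)
  next
    case False
    then show ?thesis using x split_reach_iff[OF r] arb by (auto simp: arborescence_def)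
  qed
qed

lemma split_min_label_lift:
  assumes x: "x \<in> V"
  shows "min_label g (lift x) = min_label f x"
proof (rule min_label_eqI[OF fin arb x N])
  have "subtree g (lift x) \<subseteq> insert N V"
    using x by (intro subtree_subset[OF split_arborescence]) (auto simp: lift_def)
  then show "subtree g (lift x) - {N} = subtree f x"
    using split_reach_iff[OF x] subtree_subset[OF arb x] N_notin unfolding subtree_def by blast
qed

lemma split_min_label:
  assumes "x \<in> V" "x \<noteq> i"
  shows "min_label g x = min_label f x"
  using split_min_label_lift[OF assms(1)] assms(2) by (simp add: lift_def)

lemma split_min_label_le: "x \<in> V \<Longrightarrow> d \<in> subtree g x \<Longrightarrow> min_label g x \<le> d"
  using split_arborescence fin by (intro min_label_le[of "insert N V"]) auto

text \<open>All edges below \<open>N\<close> are improper since \<open>N\<close> is the largest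
  label, and those to \<open>S\<close> correspond to edges that already were. The edge to
  \<open>N\<close>, if any, inherits the status of the former edge to \<open>i\<close>, and the edge
  from \<open>N\<close> to \<open>i\<close> is improper. So exactly one element is gained,
  \<open>N\<close> or \<open>i\<close>.\<close>

lemma split_improper_children:
  assumes "\<And>c. c \<in> S \<Longrightarrow> min_label f c < i"
  shows "improper_children g =
    (if i \<in> improper_children f then insert N (improper_children f) else insert i (improper_children f))"
proof -
  have "j \<in> improper_children g \<longleftrightarrow>
    j = i \<or> (j = N \<and> i \<in> improper_children f) \<or> (j \<noteq> N \<and> j \<in> improper_children f)" for j
  proof -
    consider "j = N" | "j = i" | "j \<in> S" | "j \<noteq> N" "j \<noteq> i" "j \<notin> S" by blast
    then show ?thesis
    proof cases
      case 1
      then show ?thesis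
        using split_min_label_lift[OF i]
        by (auto simp: improper_children_def split_vertex_def lift_def)
    next
      case 2
      have "min_label g i < N" using split_min_label_le[OF i subtree_refl] N[OF i] by simp
      then show ?thesis using 2 by (simp add: improper_children_def split_vertex_def)
    next
      case 3
      then have j: "j \<in> V" "j \<noteq> i" "j \<noteq> N" using S_in_V N_neq by auto
      have "min_label g j < N" using split_min_label_le[OF j(1) subtree_refl] N[OF j(1)] by simp
      moreover have "f j = Some i" using 3 S by auto
      ultimately show ?thesis using 3 j assms by (simp add: improper_children_def split_vertex_def)
    next
      case 4
      have "j \<in> V" if "f j = Some p" for p using arborescence_arc[OF arb that] by simp
      then show ?thesis
        using 4 split_min_label[of j] by (auto simp: improper_children_def split_vertex_def)
    qed
  qed
  moreover have "N \<notin> improper_children f" by (simp add: improper_children_def)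
  ultimately show ?thesis by auto
qed

lemma card_split_improper_children:
  assumes "\<And>c. c \<in> S \<Longrightarrow> min_label f c < i"
  shows "card (improper_children g) = Suc (card (improper_children f))"
proof -
  have "improper_children f \<subseteq> V"
    using arborescence_arc[OF arb] by (auto simp: improper_children_def)
  then have "finite (improper_children f)" "N \<notin> improper_children f"
    using fin N_notin finite_subset by auto
  then show ?thesis by (simp add: split_improper_children[OF assms])
qed

text \<open>Among the children of \<open>N\<close>, the vertex \<open>i\<close> is recognised as the one with the largest
  \<^const>\<open>min_label\<close>.\<close>

lemma initial_children_iff:
  "initial_children f i S \<longleftrightarrow> (\<forall>c\<in>S. min_label g c < min_label g i)"
proof
  assume a: "initial_children f i S"
  show "\<forall>c\<in>S. min_label g c < min_label g i"
  proof
    fix c assume c: "c \<in> S"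
    \<comment> \<open>In \<open>g\<close> this least label below \<open>i\<close> is either
      \<open>i\<close> itself or lies below a child of \<open>i\<close> left outside
      \<open>S\<close>. The two cases use the two bounds in \<open>initial_children\<close>.\<close>
    let ?d = "min_label g i"
    have mc: "min_label g c = min_label f c"
      using c S_in_V N_neq by (intro split_min_label) auto
    have "?d \<in> subtree g i"
      using split_arborescence fin i by (intro min_label_in[of "insert N V"]) auto
    then have "(i, ?d) \<in> (arcs g)\<^sup>*" by (simp add: subtree_def)
    then show "min_label g c < min_label g i"
    proof (cases rule: converse_rtranclE)
      case base
      then show ?thesis using a c mc by (auto simp: initial_children_def)
    next
      case (step c')
      then have c': "f c' = Some i" "c' \<notin> S" "c' \<noteq> i"
        by (auto simp: split_vertex_def split: if_splits)
      then have "c' \<in> V" using arborescence_arc[OF arb] by blast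
      then have "min_label f c' \<le> ?d"
        using split_min_label_le[of c' ?d] split_min_label[of c'] c' step by (simp add: subtree_def)
      moreover have "min_label f c < min_label f c'" using a c c' by (auto simp: initial_children_def)
      ultimately show ?thesis using mc by simp
    qed
  qed
next
  assume a: "\<forall>c\<in>S. min_label g c < min_label g i"
  \<comment> \<open>The value \<open>min_label g i\<close> separates: it is above the minima of
    \<open>S\<close>, and at most \<open>i\<close> and at most the minimum of each remaining
    child.\<close>
  have mi: "min_label g i \<le> i" using split_min_label_le[OF i subtree_refl] .
  have mc: "min_label f c < min_label g i" if "c \<in> S" for c
    using a that split_min_label[of c] S_in_V[of c] N_neq(6) by fastforce
  show "initial_children f i S"
    unfolding initial_children_def
  proof (intro conjI ballI S)
    fix c assume c: "c \<in> S"
    show "min_label f c < i" using mc[OF c] mi by simp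
    fix c' assume c': "c' \<in> {c. f c = Some i} - S"
    then have "c' \<in> V" "c' \<noteq> i" "c' \<noteq> N" using arborescence_arc[OF arb] by auto
    moreover have "c' \<in> subtree g i"
      using c' calculation by (auto simp: subtree_def split_vertex_def)
    then have "min_label g i \<le> min_label g c'"
      using split_arborescence fin i by (intro min_label_mono[of "insert N V"]) auto
    ultimately show "min_label f c < min_label f c'"
      using mc[OF c] split_min_label[of c'] by simp
  qed
qed

lemma merge_split: "merge_vertex N i g = f"
  using S by (auto simp: fun_eq_iff merge_vertex_def split_vertex_def)

end

text \<open>The children of \<open>N\<close> are \<open>i\<close> and \<open>S\<close>, among which
  \<open>i\<close> has the largest \<open>min_label\<close>. So the split map determines
  \<open>i\<close>, then \<open>S\<close>, and merging returns \<open>f\<close>.\<close>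

lemma split_vertex_inj:
  assumes "vertex_split V r f N i S" "vertex_split V r' f' N i' S'"
    and "initial_children f i S" "initial_children f' i' S'"
    and eq: "split_vertex N i S f = split_vertex N i' S' f'"
  shows "f = f' \<and> i = i' \<and> S = S'"
proof -
  interpret a: vertex_split V r f N i S by fact
  interpret b: vertex_split V r' f' N i' S' by fact
  have ch: "insert i S = insert i' S'"
    using a.split_child_iff b.split_child_iff eq by auto
  have m: "\<forall>c\<in>S. min_label a.g c < min_label a.g i" "\<forall>c\<in>S'. min_label a.g c < min_label a.g i'"
    using a.initial_children_iff b.initial_children_iff assms eq by auto
  have i: "i = i'"
  proof (rule ccontr)
    assume "i \<noteq> i'"
    then have "i \<in> S'" "i' \<in> S" using ch by auto
    then show False using m by (meson less_asym)
  qed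
  moreover have "S = S'" using ch i a.N_neq(6) b.N_neq(6) by (metis insert_ident)
  moreover have "f = f'" using a.merge_split b.merge_split eq i by metis
  ultimately show ?thesis by simp
qed

text \<open>Contracting the edge from \<open>N\<close> to any child \<open>i\<close> preserves
  reachability from the root; if \<open>N\<close> was the root, \<open>i\<close> takes over.\<close>

lemma merge_arborescence:
  assumes g: "arborescence (insert N V) r g" and N: "N \<notin> V" and i: "g i = Some N"
  shows "arborescence V (if r = N then i else r) (merge_vertex N i g)"
  unfolding arborescence_def
proof (intro conjI ballI)
  note loop = arborescence_no_loop[OF g]
  have iN: "i \<noteq> N" "N \<noteq> i" using loop i by auto
  have iV: "i \<in> V" using arborescence_arc[OF g i] iN by auto
  note dom = arborescence_None_iff[OF g]
  have r: "r \<in> insert N V" using g by (simp add: arborescence_def)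
  let ?f = "merge_vertex N i g" and ?r = "if r = N then i else r"
  show "?r \<in> V" using r iV by auto
  have "i \<noteq> r" using dom[of i] i by auto
  then have "?f x = None \<longleftrightarrow> x \<notin> V \<or> x = ?r" for x
    using dom[of x] dom[of N] iN iV N by (auto simp: merge_vertex_def)
  then show "dom ?f = V - {?r}" by (intro set_eqI) (simp add: domIff)
  show "ran ?f \<subseteq> V"
  proof
    fix y assume "y \<in> ran ?f"
    then obtain x where "?f x = Some y" by (auto simp: ran_def)
    then show "y \<in> V"
      using arborescence_arc(1)[OF g, of _ y] loop[of N] iV
      by (auto simp: merge_vertex_def split: if_splits)
  qed
  have *: "(?r, if y = N then i else y) \<in> (arcs ?f)\<^sup>*" if "(r, y) \<in> (arcs g)\<^sup>*" for y
    using that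
  proof (induction rule: rtrancl_induct)
    case (step y z)
    have "(if y = N then i else y, if z = N then i else z) \<in> (arcs ?f)\<^sup>="
      using step(2) i iN by (auto simp: merge_vertex_def)
    then show ?case using step.IH by (auto intro: rtrancl_into_rtrancl)
  qed simp
  fix x assume x: "x \<in> V"
  then have "(r, x) \<in> (arcs g)\<^sup>*" using g by (auto simp: arborescence_def)
  from *[OF this] show "(?r, x) \<in> (arcs ?f)\<^sup>*" using x N by (auto split: if_splits)
qed

lemma split_merge:
  assumes "arborescence (insert N V) r g" "g i = Some N"
  shows "split_vertex N i ({c. g c = Some N} - {i}) (merge_vertex N i g) = g"
proof -
  have "g N \<noteq> Some N" using arborescence_no_loop[OF assms(1)] .
  then show ?thesis using assms(2) by (auto simp: fun_eq_iff split_vertex_def merge_vertex_def)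
qed

lemma bij_betw_split_vertex:
  fixes V :: "'v::linorder set"
  assumes fin: "finite V" and N: "\<And>x. x \<in> V \<Longrightarrow> x < N"
  shows "bij_betw (\<lambda>(f, i, S). split_vertex N i S f)
    (SIGMA f:arborescences V. SIGMA i:V. {S. initial_children f i S})
    {g \<in> arborescences (insert N V). \<exists>c. g c = Some N}"
  unfolding bij_betw_def
proof
  let ?A = "SIGMA f:arborescences V. SIGMA i:V. {S. initial_children f i S}"
  have vs: "\<exists>r. vertex_split V r f N i S" if "(f, i, S) \<in> ?A" for f i S
  proof -
    from that obtain r where "arborescence V r f" by (auto simp: arborescences_def)
    then have "vertex_split V r f N i S"
      using that fin N by unfold_locales (auto simp: initial_children_def)
    then show ?thesis ..
  qed
  show "inj_on (\<lambda>(f, i, S). split_vertex N i S f) ?A"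
  proof (rule inj_onI)
    fix p q
    assume p: "p \<in> ?A" and q: "q \<in> ?A"
      and eq: "(case p of (f, i, S) \<Rightarrow> split_vertex N i S f) = (case q of (f, i, S) \<Rightarrow> split_vertex N i S f)"
    obtain f i S where "p = (f, i, S)" by (cases p)
    moreover obtain f' i' S' where "q = (f', i', S')" by (cases q)
    ultimately have pq: "p = (f, i, S)" "q = (f', i', S')" .
    then obtain r r' where "vertex_split V r f N i S" "vertex_split V r' f' N i' S'"
      using vs p q by meson
    then show "p = q" using split_vertex_inj[of V r f N i S r' f' i' S'] p q eq by (auto simp: pq)
  qed
  show "(\<lambda>(f, i, S). split_vertex N i S f) ` ?A = {g \<in> arborescences (insert N V). \<exists>c. g c = Some N}"
    (is "?L = ?R")
  proof
    show "?L \<subseteq> ?R"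
    proof clarify
      fix f i S assume a: "f \<in> arborescences V" "i \<in> V" "initial_children f i S"
      then obtain r where "vertex_split V r f N i S" using vs by (metis SigmaI mem_Collect_eq)
      then interpret vertex_split V r f N i S .
      show "split_vertex N i S f \<in> arborescences (insert N V) \<and> (\<exists>c. split_vertex N i S f c = Some N)"
        using split_arborescence split_child_iff by (auto simp: arborescences_def)
    qed
    show "?R \<subseteq> ?L"
    proof clarify
      fix g c assume "g \<in> arborescences (insert N V)" and c: "g c = Some N"
      then obtain r where g: "arborescence (insert N V) r g" by (auto simp: arborescences_def)
      let ?C = "{c. g c = Some N}"
      have "?C \<subseteq> insert N V" using arborescence_arc[OF g] by blast
      then have finC: "finite ?C" using fin finite_subset by blast
      \<comment> \<open>The child of \<open>N\<close> with the largest \<open>min_label\<close> is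
        the one to merge with; the other children form \<open>S\<close>.\<close>
      then have "Max (min_label g ` ?C) \<in> min_label g ` ?C" using c by (intro Max_in) auto
      then obtain i where im: "g i = Some N" "Max (min_label g ` ?C) = min_label g i" by auto
      define S where "S = ?C - {i}"
      define f where "f = merge_vertex N i g"
      have NV: "N \<notin> V" using N by blast
      have loop: "g N \<noteq> Some N" using arborescence_no_loop[OF g] .
      have f: "arborescence V (if r = N then i else r) f"
        unfolding f_def by (rule merge_arborescence[OF g NV im(1)])
      have iV: "i \<in> V" using arborescence_arc[OF g im(1)] im(1) loop by auto
      have S: "S \<subseteq> {c. f c = Some i}" using loop by (auto simp: S_def f_def merge_vertex_def)
      interpret vertex_split V "if r = N then i else r" f N i S
        using fin N f iV S by unfold_locales
      have eq: "split_vertex N i S f = g"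
        unfolding f_def S_def by (rule split_merge[OF g im(1)])
      have "min_label g c < min_label g i" if "c \<in> S" for c
      proof -
        have "min_label g c \<le> min_label g i"
          using that im(2)[symmetric] finC by (auto simp: S_def intro: Max_ge)
        moreover have "min_label g c \<noteq> min_label g i"
          using min_label_siblings[of "insert N V" r g N] fin g that im(1)
          by (auto simp: S_def inj_on_def)
        ultimately show ?thesis by simp
      qed
      then have "initial_children f i S" using initial_children_iff eq by simp
      then have "(f, i, S) \<in> ?A" using f iV by (auto simp: arborescences_def)
      then show "g \<in> ?L" using eq by force
    qed
  qed
qed

text \<open>A nonempty admissible set is fixed by its element \<open>j\<close> with the largest
  \<open>b j\<close>: it consists of all of \<open>A\<close> up to \<open>b j\<close>, and any
  \<open>j\<close> with \<open>b j < t\<close> may occur. The empty set accounts for the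
  \<open>Suc\<close>.\<close>

lemma card_initial_segments:
  fixes b :: "'a \<Rightarrow> 'b::linorder"
  assumes fin: "finite A" and inj: "inj_on b A"
  shows "card {S. S \<subseteq> A \<and> (\<forall>c\<in>S. b c < t) \<and> (\<forall>c\<in>S. \<forall>c'\<in>A - S. b c < b c')} =
    Suc (card {c \<in> A. b c < t})"
proof -
  let ?J = "{c \<in> A. b c < t}" and ?I = "\<lambda>j. {c \<in> A. b c \<le> b j}"
  have "{S. S \<subseteq> A \<and> (\<forall>c\<in>S. b c < t) \<and> (\<forall>c\<in>S. \<forall>c'\<in>A - S. b c < b c')} = insert {} (?I ` ?J)"
    (is "?L = ?R")
  proof
    show "?R \<subseteq> ?L" by auto
    show "?L \<subseteq> ?R"
    proof
      fix S assume S: "S \<in> ?L"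
      show "S \<in> ?R"
      proof (cases "S = {}")
        case False
        have "finite S" using S fin finite_subset by auto
        then have "Max (b ` S) \<in> b ` S" using False by (intro Max_in) auto
        then obtain j where j: "j \<in> S" "Max (b ` S) = b j" by auto
        then have "c \<in> S \<Longrightarrow> b c \<le> b j" for c using \<open>finite S\<close> Max_ge[of "b ` S" "b c"] by simp
        then have "S \<subseteq> ?I j" using S by blast
        moreover have "?I j \<subseteq> S"
        proof
          fix c assume "c \<in> ?I j"
          then have "c \<in> A" "\<not> b j < b c" by auto
          then show "c \<in> S" using S j(1) by blast
        qed
        ultimately have "S = ?I j" by (rule equalityI)
        then show ?thesis using S j(1) by blast
      qed simp
    qed
  qed
  moreover have "inj_on ?I ?J"
  proof (rule inj_onI)
    fix j j' assume "j \<in> ?J" "j' \<in> ?J" "?I j = ?I j'"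
    then have "j \<in> ?I j'" "j' \<in> ?I j" by blast+
    then have "b j = b j'" by (simp add: order_antisym)
    then show "j = j'" using inj \<open>j \<in> ?J\<close> \<open>j' \<in> ?J\<close> by (auto dest: inj_onD)
  qed
  moreover have "{} \<notin> ?I ` ?J" by auto
  ultimately show ?thesis using fin by (simp add: card_image)
qed

text \<open>Every vertex contributes one for the empty set, and every improper edge is counted once,
  at its parent.\<close>

lemma sum_card_initial_children:
  assumes fin: "finite V" and f: "arborescence V r f"
  shows "(\<Sum>i\<in>V. card {S. initial_children f i S}) = card V + card (improper_children f)"
proof -
  let ?J = "\<lambda>i. {c \<in> {c. f c = Some i}. min_label f c < i}"
  have ch: "{c. f c = Some i} \<subseteq> V" for i using arborescence_arc[OF f] by blast
  have "card {S. initial_children f i S} = Suc (card (?J i))" for i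
    unfolding initial_children_def
    using card_initial_segments[OF _ min_label_siblings[OF fin f, of i], where t = i]
      finite_subset[OF ch fin] by blast
  moreover have "card (improper_children f) = (\<Sum>i\<in>V. card (?J i))"
  proof -
    have "improper_children f = (\<Union>i\<in>V. ?J i)"
      using arborescence_arc[OF f] by (auto simp: improper_children_def)
    also have "card \<dots> = (\<Sum>i\<in>V. card (?J i))"
      using fin finite_subset[OF ch fin] by (intro card_UN_disjoint) auto
    finally show ?thesis .
  qed
  ultimately show ?thesis by (simp add: sum_Suc)
qed

section \<open>Adding a leaf\<close>

lemma arborescence_add_leaf:
  assumes f: "arborescence V r f" and N: "N \<notin> V" and i: "i \<in> V"
  shows "arborescence (insert N V) r (f(N \<mapsto> i))"
  unfolding arborescence_def
proof (intro conjI ballI)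
  let ?g = "f(N \<mapsto> i)"
  have r: "r \<in> V" and dom: "dom f = V - {r}" and ran: "ran f \<subseteq> V" using f by (auto simp: arborescence_def)
  show "r \<in> insert N V" using r by simp
  show "dom ?g = insert N V - {r}" using dom r N by auto
  show "ran ?g \<subseteq> insert N V" using ran i by (auto simp: ran_def)
  have fN: "f N = None" using arborescence_None_iff[OF f] N by simp
  then have "arcs f \<subseteq> arcs ?g" by auto
  then have sub: "(arcs f)\<^sup>* \<subseteq> (arcs ?g)\<^sup>*" by (rule rtrancl_mono)
  then have V: "(r, x) \<in> (arcs ?g)\<^sup>*" if "x \<in> V" for x
    using that f by (auto simp: arborescence_def)
  fix x assume "x \<in> insert N V"
  moreover have "(i, N) \<in> arcs ?g" by simp
  then have "(r, N) \<in> (arcs ?g)\<^sup>*" using V[OF i] by (rule rtrancl_into_rtrancl[rotated])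
  ultimately show "(r, x) \<in> (arcs ?g)\<^sup>*" using V by auto
qed

text \<open>A leaf has no outgoing arc, so a chain that does not end in \<open>N\<close> never
  passes through it.\<close>

lemma reach_without_leaf:
  assumes "\<nexists>c. g c = Some N" "(x, y) \<in> (arcs g)\<^sup>*" "y \<noteq> N"
  shows "(x, y) \<in> (arcs (g(N := None)))\<^sup>*"
  using assms(2,3)
proof (induction rule: rtrancl_induct)
  case (step y z)
  have "y \<noteq> N" using assms(1) step(2) by auto
  moreover have "(y, z) \<in> arcs (g(N := None))" using step(2,4) by simp
  ultimately show ?case using step.IH by (meson rtrancl_into_rtrancl)
qed simp

lemma arborescence_remove_leaf:
  assumes g: "arborescence (insert N V) r g" and N: "N \<notin> V" and leaf: "\<nexists>c. g c = Some N"
    and V: "V \<noteq> {}"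
  shows "arborescence V r (g(N := None))"
  unfolding arborescence_def
proof (intro conjI ballI)
  let ?f = "g(N := None)"
  have r: "r \<in> insert N V" and dom: "dom g = insert N V - {r}" and ran: "ran g \<subseteq> insert N V"
    and reach: "\<And>x. x \<in> insert N V \<Longrightarrow> (r, x) \<in> (arcs g)\<^sup>*"
    using g by (auto simp: arborescence_def)
  \<comment> \<open>If \<open>N\<close> were the root, a vertex of \<open>V\<close> could be reached
    only through a child of \<open>N\<close>.\<close>
  have "r \<noteq> N"
  proof
    assume rN: "r = N"
    obtain x where x: "x \<in> V" using V by blast
    then have "(N, x) \<in> (arcs g)\<^sup>*" using reach rN by blast
    then show False
      by (cases rule: converse_rtranclE) (use x N leaf in auto)
  qed
  then show "r \<in> V" using r by simp
  show "dom ?f = V - {r}" using dom N by auto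
  show "ran ?f \<subseteq> V" using ran leaf by (auto simp: ran_def)
  fix x assume "x \<in> V"
  then show "(r, x) \<in> (arcs ?f)\<^sup>*" using reach reach_without_leaf[OF leaf] N by blast
qed

lemma bij_betw_add_leaf:
  assumes N: "N \<notin> V" and V: "V \<noteq> {}"
  shows "bij_betw (\<lambda>(f, i). f(N \<mapsto> i)) (arborescences V \<times> V)
    {g \<in> arborescences (insert N V). \<nexists>c. g c = Some N}"
proof (rule bij_betw_byWitness[where f' = "\<lambda>g. (g(N := None), the (g N))"])
  have None: "f N = None" "f c \<noteq> Some N" if f: "f \<in> arborescences V" for f c
  proof -
    obtain r where f: "arborescence V r f" using f by (auto simp: arborescences_def)
    show "f N = None" using arborescence_None_iff[OF f] N by simp
    show "f c \<noteq> Some N" using arborescence_arc(1)[OF f, of c N] N by auto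
  qed
  have remove: "g(N := None) \<in> arborescences V \<and> (\<exists>i\<in>V. g N = Some i)"
    if g: "g \<in> arborescences (insert N V)" and leaf: "\<nexists>c. g c = Some N" for g
  proof -
    from g obtain r where r: "arborescence (insert N V) r g" by (auto simp: arborescences_def)
    have f: "arborescence V r (g(N := None))" by (rule arborescence_remove_leaf[OF r N leaf V])
    then have "N \<noteq> r" using N by (auto simp: arborescence_def)
    then obtain i where i: "g N = Some i" using arborescence_parent[OF r, of N] by blast
    moreover have "i \<in> V" using arborescence_arc(1)[OF r i] leaf i by auto
    ultimately show ?thesis using f by (auto simp: arborescences_def)
  qed
  show "\<forall>p\<in>arborescences V \<times> V. (\<lambda>g. (g(N := None), the (g N))) (case p of (f, i) \<Rightarrow> f(N \<mapsto> i)) = p"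
    using None by (auto simp: fun_upd_idem)
  show "\<forall>g\<in>{g \<in> arborescences (insert N V). \<nexists>c. g c = Some N}.
      (case (g(N := None), the (g N)) of (f, i) \<Rightarrow> f(N \<mapsto> i)) = g"
    using remove by fastforce
  show "(\<lambda>(f, i). f(N \<mapsto> i)) ` (arborescences V \<times> V) \<subseteq>
      {g \<in> arborescences (insert N V). \<nexists>c. g c = Some N}"
  proof clarify
    fix f i assume f: "f \<in> arborescences V" and i: "i \<in> V"
    then obtain r where "arborescence V r f" by (auto simp: arborescences_def)
    then have "f(N \<mapsto> i) \<in> arborescences (insert N V)"
      using arborescence_add_leaf[OF _ N i] by (auto simp: arborescences_def)
    then show "f(N \<mapsto> i) \<in> arborescences (insert N V) \<and> (\<nexists>c. (f(N \<mapsto> i)) c = Some N)"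
      using None(2)[OF f] N i by auto
  qed
  show "(\<lambda>g. (g(N := None), the (g N))) ` {g \<in> arborescences (insert N V). \<nexists>c. g c = Some N}
      \<subseteq> arborescences V \<times> V"
    using remove by fastforce
qed

text \<open>The leaf \<open>N\<close> is its own only descendant and exceeds its parent, so the new
  edge is proper; as the largest label it changes no other minimum.\<close>

lemma improper_children_add_leaf:
  fixes V :: "'v::linorder set"
  assumes fin: "finite V" and f: "arborescence V r f" and N: "\<And>x. x \<in> V \<Longrightarrow> x < N" and i: "i \<in> V"
  shows "improper_children (f(N \<mapsto> i)) = improper_children f"
proof -
  let ?g = "f(N \<mapsto> i)"
  have NV: "N \<notin> V" using N by blast
  have fN: "f N = None" using arborescence_None_iff[OF f] NV by simp
  have leaf: "\<nexists>c. ?g c = Some N" using arborescence_arc[OF f] NV i by auto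
  have "(N, d) \<in> (arcs ?g)\<^sup>* \<Longrightarrow> d = N" for d
    using leaf by (auto elim: converse_rtranclE)
  then have "subtree ?g N = {N}" by (auto simp: subtree_def)
  then have mN: "min_label ?g N = N" by (simp add: min_label_def)
  have m: "min_label ?g x = min_label f x" if x: "x \<in> V" for x
  proof (rule min_label_eqI[OF fin f x N])
    have "arcs f \<subseteq> arcs ?g" using fN by auto
    then have "(arcs f)\<^sup>* \<subseteq> (arcs ?g)\<^sup>*" by (rule rtrancl_mono)
    then have "subtree f x \<subseteq> subtree ?g x" by (auto simp: subtree_def)
    moreover have "?g(N := None) = f" using fN by auto
    note reach_without_leaf[OF leaf, of x, unfolded this]
    then have "y \<in> subtree f x" if "y \<in> subtree ?g x" "y \<noteq> N" for y
      using that unfolding subtree_def by blast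
    moreover have "N \<notin> subtree f x" using subtree_subset[OF f x] NV by blast
    ultimately show "subtree ?g x - {N} = subtree f x" by blast
  qed
  have "j \<in> improper_children ?g \<longleftrightarrow> j \<in> improper_children f" for j
    using m[of j] mN fN N[OF i] arborescence_arc(2)[OF f, of j]
    by (cases "j = N") (auto simp: improper_children_def)
  then show ?thesis by blast
qed

section \<open>The recurrence for the tree polynomials\<close>

text \<open>The sum is divided by whether \<open>N\<close> is a leaf. The value \<open>x\<close>
  ranges over any commutative semiring so that the Laurent variable \<open>u\<close> can be
  substituted.\<close>

lemma sum_arborescences_insert:
  fixes V :: "'v::linorder set" and x :: "'a::comm_semiring_1"
  assumes fin: "finite V" and V: "V \<noteq> {}" and N: "\<And>x. x \<in> V \<Longrightarrow> x < N"
  defines "k \<equiv> \<lambda>f :: 'v \<rightharpoonup> 'v. card (improper_children f)"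
  shows "(\<Sum>g\<in>arborescences (insert N V). x ^ k g) =
    (\<Sum>f\<in>arborescences V. of_nat (card V) * x ^ k f + of_nat (card V + k f) * x ^ Suc (k f))"
proof -
  let ?A = "arborescences V" and ?B = "arborescences (insert N V)"
  let ?C = "SIGMA f:?A. SIGMA i:V. {S. initial_children f i S}"
  have NV: "N \<notin> V" using N by blast
  have arb: "\<exists>r. arborescence V r f" if "f \<in> ?A" for f using that by (simp add: arborescences_def)
  have finS: "finite {S. initial_children f i S}" if f: "f \<in> ?A" for f i
  proof (rule finite_subset)
    obtain r where r: "arborescence V r f" using arb[OF f] by blast
    have "{c. f c = Some i} \<subseteq> V" using arborescence_arc(2)[OF r] by blast
    then show "{S. initial_children f i S} \<subseteq> Pow V" unfolding initial_children_def by blast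
  qed (use fin in simp)
  have finA: "finite ?A" "finite ?B" using fin by (auto intro: finite_arborescences)
  have "(\<Sum>g\<in>{g \<in> ?B. \<nexists>c. g c = Some N}. x ^ k g) = (\<Sum>(f, i)\<in>?A \<times> V. x ^ k (f(N \<mapsto> i)))"
    by (subst sum.reindex_bij_betw[OF bij_betw_add_leaf[OF NV V], symmetric])
      (simp add: case_prod_beta)
  also have "\<dots> = (\<Sum>(f, i)\<in>?A \<times> V. x ^ k f)"
  proof (intro sum.cong refl, clarify)
    fix f i assume "f \<in> ?A" and i: "i \<in> V"
    then obtain r where "arborescence V r f" using arb by blast
    then show "x ^ k (f(N \<mapsto> i)) = x ^ k f"
      using improper_children_add_leaf[OF fin _ N i] by (simp add: k_def)
  qed
  also have "\<dots> = (\<Sum>f\<in>?A. of_nat (card V) * x ^ k f)"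
    by (simp flip: sum.cartesian_product)
  finally have leaf: "(\<Sum>g\<in>{g \<in> ?B. \<nexists>c. g c = Some N}. x ^ k g) = \<dots>" .
  have "(\<Sum>g\<in>{g \<in> ?B. \<exists>c. g c = Some N}. x ^ k g) = (\<Sum>(f, i, S)\<in>?C. x ^ k (split_vertex N i S f))"
    by (subst sum.reindex_bij_betw[OF bij_betw_split_vertex[OF fin N], symmetric])
      (simp_all add: case_prod_beta)
  also have "\<dots> = (\<Sum>(f, i, S)\<in>?C. x ^ Suc (k f))"
  proof (intro sum.cong refl, clarify)
    fix f i S assume "f \<in> ?A" "i \<in> V" and ini: "initial_children f i S"
    moreover from arb[OF \<open>f \<in> ?A\<close>] obtain r where "arborescence V r f" by blast
    ultimately interpret vertex_split V r f N i S
      using fin N by unfold_locales (auto simp: initial_children_def)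
    have "k g = Suc (k f)"
      unfolding k_def using ini by (intro card_split_improper_children) (auto simp: initial_children_def)
    then show "x ^ k g = x ^ Suc (k f)" by simp
  qed
  also have "\<dots> = (\<Sum>f\<in>?A. \<Sum>(i, S)\<in>(SIGMA i:V. {S. initial_children f i S}). x ^ Suc (k f))"
    using finA fin finS by (subst sum.Sigma) (auto simp: case_prod_beta)
  also have "\<dots> = (\<Sum>f\<in>?A. of_nat (card V + k f) * x ^ Suc (k f))"
  proof (rule sum.cong[OF refl])
    fix f assume f: "f \<in> ?A"
    from arb[OF f] obtain r where "arborescence V r f" by blast
    then have "(\<Sum>i\<in>V. card {S. initial_children f i S}) = card V + k f"
      using sum_card_initial_children fin unfolding k_def by blast
    then have "card (SIGMA i:V. {S. initial_children f i S}) = card V + k f"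
      using fin finS[OF f] by simp
    then show "(\<Sum>(i, S)\<in>(SIGMA i:V. {S. initial_children f i S}). x ^ Suc (k f)) =
        of_nat (card V + k f) * x ^ Suc (k f)"
      by (simp add: case_prod_beta del: card_SigmaI)
  qed
  finally have inner: "(\<Sum>g\<in>{g \<in> ?B. \<exists>c. g c = Some N}. x ^ k g) = \<dots>" .
  have "?B = {g \<in> ?B. \<nexists>c. g c = Some N} \<union> {g \<in> ?B. \<exists>c. g c = Some N}" by blast
  then have "(\<Sum>g\<in>?B. x ^ k g) =
      (\<Sum>g\<in>{g \<in> ?B. \<nexists>c. g c = Some N}. x ^ k g) + (\<Sum>g\<in>{g \<in> ?B. \<exists>c. g c = Some N}. x ^ k g)"
    using finA(2) by (subst sum.union_disjoint[symmetric]) auto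
  then show ?thesis by (simp only: leaf inner sum.distrib)
qed

section \<open>Rooted trees correspond to parent maps\<close>

definition tree_of :: "'v set \<Rightarrow> ('v \<rightharpoonup> 'v) \<Rightarrow> 'v \<times> 'v set set" where
  "tree_of V f = (THE r. r \<in> V \<and> f r = None, undirected f)"

lemma tree_of_eq:
  assumes "arborescence V r f"
  shows "tree_of V f = (r, undirected f)"
proof -
  have "(THE r. r \<in> V \<and> f r = None) = r"
    using assms arborescence_None_iff[OF assms] by (intro the_equality) (auto simp: arborescence_def)
  then show ?thesis by (simp add: tree_of_def)
qed

text \<open>Injectivity holds because the \<open>child_edges\<close> of the tree are
  \<open>arcs f\<close>, which determine \<open>f\<close>; surjectivity comes from
  \<open>tree_imp_arborescence\<close>.\<close>

lemma bij_betw_tree_of: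
  assumes "finite V"
  shows "bij_betw (tree_of V) (arborescences V) {T. rooted_tree V T}"
  unfolding bij_betw_def
proof
  show "inj_on (tree_of V) (arborescences V)"
  proof (rule inj_onI)
    fix f f' assume "f \<in> arborescences V" "f' \<in> arborescences V" and eq: "tree_of V f = tree_of V f'"
    then obtain r r' where r: "arborescence V r f" "arborescence V r' f'"
      by (auto simp: arborescences_def)
    then have "arcs f = arcs f'"
      using eq child_edges_undirected[OF r(1)] child_edges_undirected[OF r(2)]
      by (simp add: tree_of_eq)
    then have "f j = Some i \<longleftrightarrow> f' j = Some i" for i j by (metis arcs_iff)
    then show "f = f'" by (metis ext not_None_eq)
  qed
  show "tree_of V ` arborescences V = {T. rooted_tree V T}"
  proof
    show "tree_of V ` arborescences V \<subseteq> {T. rooted_tree V T}"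
    proof (intro image_subsetI CollectI)
      fix f assume "f \<in> arborescences V"
      then obtain r where f: "arborescence V r f" by (auto simp: arborescences_def)
      then have "r \<in> V" by (simp add: arborescence_def)
      then show "rooted_tree V (tree_of V f)"
        using tree_undirected[OF f assms] by (simp add: tree_of_eq[OF f] rooted_tree_def)
    qed
    show "{T. rooted_tree V T} \<subseteq> tree_of V ` arborescences V"
    proof clarify
      fix r E assume "rooted_tree V (r, E)"
      then have "tree V E" "r \<in> V" by (auto simp: rooted_tree_def)
      then obtain f where f: "arborescence V r f" "undirected f = E" by (rule tree_imp_arborescence)
      then have "tree_of V f = (r, E)" by (simp add: tree_of_eq)
      then show "(r, E) \<in> tree_of V ` arborescences V" using f by (force simp: arborescences_def)
    qed
  qed
qed

lemma card_improper_edges_tree_of: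
  fixes V :: "nat set"
  assumes fin: "finite V" and "f \<in> arborescences V"
  shows "card (improper_edges (tree_of V f)) = card (improper_children f)"
proof -
  obtain r where f: "arborescence V r f" using assms by (auto simp: arborescences_def)
  have "(\<exists>d\<in>descendants (r, undirected f) j. d < i) \<longleftrightarrow> min_label f j < i" if "f j = Some i" for i j
  proof -
    have j: "j \<in> V" using arborescence_arc[OF f that] by simp
    have "descendants (r, undirected f) j = subtree f j"
      using descendants_undirected[OF f j] by (simp add: subtree_def)
    moreover have "finite (subtree f j)" "subtree f j \<noteq> {}"
      using finite_subset[OF subtree_subset[OF f j] fin] subtree_refl[of j f] by blast+
    ultimately show ?thesis by (simp add: min_label_def Min_less_iff)
  qed
  then have "improper_edges (r, undirected f) = {(i, j). f j = Some i \<and> min_label f j < i}"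
    by (auto simp: improper_edges_def child_edges_undirected[OF f])
  then have "improper_edges (tree_of V f) = (\<lambda>j. (the (f j), j)) ` improper_children f"
    by (force simp: tree_of_eq[OF f] improper_children_def)
  moreover have "inj_on (\<lambda>j. (the (f j), j)) (improper_children f)" by (auto intro: inj_onI)
  ultimately show ?thesis by (simp add: card_image)
qed

text \<open>The root is no child. The bound ensures that the sum up to \<open>n - 1\<close> in
  \<open>R_poly\<close> misses no tree.\<close>

lemma card_improper_children_le:
  assumes fin: "finite V" and "f \<in> arborescences V"
  shows "card (improper_children f) \<le> card V - 1"
proof -
  obtain r where f: "arborescence V r f" using assms by (auto simp: arborescences_def)
  have "improper_children f \<subseteq> V - {r}"
  proof
    fix j assume "j \<in> improper_children f"
    then obtain i where "f j = Some i" by (auto simp: improper_children_def)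
    then show "j \<in> V - {r}" using arborescence_arc(2,3)[OF f] by blast
  qed
  moreover have "r \<in> V" using f by (simp add: arborescence_def)
  ultimately show ?thesis using fin card_mono[of "V - {r}" "improper_children f"] by simp
qed

text \<open>Replaces the coefficients by one monomial per tree, so that the recurrence and
  \<open>D\<close> can both be handled tree by tree.\<close>

lemma R_poly_eq_sum:
  "R_poly n x = (\<Sum>f\<in>arborescences {1..n}. x ^ card (improper_children f))"
proof -
  let ?T = "{T. rooted_tree {1..n} T}" and ?k = "\<lambda>T. card (improper_edges T)"
  have bij: "bij_betw (tree_of {1..n}) (arborescences {1..n}) ?T" by (rule bij_betw_tree_of) simp
  have "?k T \<le> n - 1" if "T \<in> ?T" for T
  proof -
    from that obtain f where "f \<in> arborescences {1..n}" "T = tree_of {1..n} f"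
      unfolding bij_betw_imp_surj_on[OF bij, symmetric] by blast
    then show ?thesis
      using card_improper_edges_tree_of[of "{1..n}" f] card_improper_children_le[of "{1..n}" f] by simp
  qed
  then have "(\<Sum>T\<in>?T. x ^ ?k T) = (\<Sum>k = 0..n - 1. \<Sum>T\<in>{T \<in> ?T. ?k T = k}. x ^ ?k T)"
    by (intro sum.group[symmetric]) (auto intro: finite_rooted_trees)
  also have "\<dots> = R_poly n x"
    by (simp add: R_poly_def R_def)
  finally have "R_poly n x = (\<Sum>T\<in>?T. x ^ ?k T)" ..
  also have "\<dots> = (\<Sum>f\<in>arborescences {1..n}. x ^ card (improper_children f))"
    by (subst sum.reindex_bij_betw[OF bij, symmetric])
      (simp add: card_improper_edges_tree_of)
  finally show ?thesis .
qed

lemma R_poly_1: "R_poly (Suc 0) x = 1"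
proof -
  have "arborescences {Suc 0} = {Map.empty}"
    by (auto simp: arborescences_def arborescence_def)
  moreover have "card (improper_children (\<lambda>_ :: nat. None :: nat option)) = 0"
    by (simp add: improper_children_def)
  ultimately show ?thesis by (simp add: R_poly_eq_sum)
qed

lemma R_poly_Suc:
  assumes "n \<ge> 1"
  shows "R_poly (Suc n) x = (\<Sum>f\<in>arborescences {1..n}.
    let k = card (improper_children f) in of_nat n * x ^ k + of_nat (n + k) * x ^ Suc k)"
proof -
  have "{1..Suc n} = insert (Suc n) {1..n}" by auto
  then show ?thesis
    using assms sum_arborescences_insert[of "{1..n}" "Suc n" x] by (simp add: R_poly_eq_sum Let_def)
qed

section \<open>The grammar on monomials\<close>

lemma derivation_sum:
  assumes "derivation D"
  shows "D (\<Sum>i\<in>A. f i) = (\<Sum>i\<in>A. D (f i))"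
proof -
  have add: "D (f + g) = D f + D g" for f g using assms by (simp add: derivation_def)
  from add[of 0 0] have "D 0 = 0" by simp
  then show ?thesis by (induction A rule: infinite_finite_induct) (simp_all add: add)
qed

lemma derivation_power:
  assumes "derivation D"
  shows "D (f ^ Suc m) = of_nat (Suc m) * f ^ m * D f"
proof (induction m)
  case (Suc m)
  have "D (f ^ Suc (Suc m)) = D f * f ^ Suc m + f * D (f ^ Suc m)"
    using assms by (simp only: power_Suc[of f "Suc m"]) (simp only: derivation_def)
  then show ?case by (simp only: Suc.IH) (simp add: algebra_simps)
qed simp

text \<open>By the grammar, differentiating a factor \<open>z\<close> multiplies the monomial by
  \<open>v z\<close>, and a factor \<open>v\<close> or \<open>u\<close> by \<open>u v z\<close>. So
  \<open>Suc m\<close> terms keep the power of \<open>u\<close>, and \<open>Suc m + k\<close> terms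
  raise it.\<close>

lemma grammar_monomial:
  fixes D :: "'a::comm_ring_1 laurent \<Rightarrow> 'a laurent"
  assumes "grammar_derivation D"
  shows "D (var_v ^ Suc m * var_z ^ Suc m * var_u ^ k) = var_v ^ Suc (Suc m) * var_z ^ Suc (Suc m) *
    (of_nat (Suc m) * var_u ^ k + of_nat (Suc m + k) * var_u ^ Suc k)"
proof -
  note G = assms[unfolded grammar_derivation_def]
  then have D: "derivation D" by blast
  have mult: "D (f * g) = D f * g + f * D g" for f g using D by (simp only: derivation_def)
  have "D 1 = 0" using mult[of 1 1] by simp
  \<comment> \<open>The power rule covers positive exponents only; for \<open>k = 0\<close> the
    claim rests on \<open>D 1 = 0\<close>.\<close>
  then have u: "D (var_u ^ k) = of_nat k * var_u ^ Suc k * var_v * var_z"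
    using G
    by (cases k)
      (simp_all add: derivation_power[OF D] power2_eq_square ac_simps del: power_Suc of_nat_Suc,
        simp add: ac_simps)
  have v: "D (var_v ^ Suc m) = of_nat (Suc m) * var_v ^ Suc (Suc m) * var_u * var_z"
    unfolding derivation_power[OF D] using G by (simp add: power2_eq_square ac_simps)
  have z: "D (var_z ^ Suc m) = of_nat (Suc m) * var_z ^ Suc (Suc m) * var_v"
    unfolding derivation_power[OF D] using G by (simp add: power2_eq_square ac_simps)
  show ?thesis
    unfolding mult u v z by (simp add: algebra_simps)
qed

theorem theorem2p1:
  fixes D :: "'a::comm_ring_1 laurent \<Rightarrow> 'a laurent"
    and n :: nat
  assumes "derivation D"
    and "D var_z = var_v * var_z ^ 2"
    and "D var_v = var_u * var_v ^ 2 * var_z"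
    and "D var_u = var_u ^ 2 * var_v * var_z"
    and "n \<ge> 1"
  shows "(D ^^ (n - 1)) (var_v * var_z) = var_v ^ n * var_z ^ n * R_poly n var_u"
  using \<open>n \<ge> 1\<close>
proof (induction n rule: nat_induct_at_least)
  case base
  show ?case by (simp add: R_poly_1)
next
  case (Suc n)
  let ?k = "\<lambda>f :: nat \<rightharpoonup> nat. card (improper_children f)"
  obtain m where m: "n = Suc m" using Suc.hyps by (cases n) auto
  have G: "grammar_derivation D" using assms by (simp add: grammar_derivation_def)
  have "(D ^^ (Suc n - 1)) (var_v * var_z) = D ((D ^^ (n - 1)) (var_v * var_z))"
    by (simp add: m)
  \<comment> \<open>With one monomial per tree, \<open>D\<close> produces for each tree its summand
    in \<open>R_poly_Suc\<close>, up to the common powers of \<open>v\<close> and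
    \<open>z\<close>.\<close>
  also have "\<dots> = D (\<Sum>f\<in>arborescences {1..n}. var_v ^ n * var_z ^ n * var_u ^ ?k f)"
    by (simp only: Suc.IH R_poly_eq_sum sum_distrib_left)
  also have "\<dots> = (\<Sum>f\<in>arborescences {1..n}. var_v ^ Suc n * var_z ^ Suc n *
      (of_nat n * var_u ^ ?k f + of_nat (n + ?k f) * var_u ^ Suc (?k f)))"
    unfolding m by (simp only: derivation_sum[OF assms(1)] grammar_monomial[OF G])
  also have "\<dots> = var_v ^ Suc n * var_z ^ Suc n * R_poly (Suc n) var_u"
    by (simp only: R_poly_Suc[OF Suc.hyps] sum_distrib_left Let_def)
  finally show ?case .
qed

end
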